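(* Let $\phi\colon\mathbb{R}^d\to[0,\infty)$ satisfy $\phi(x)=\phi(-x)$ and $\phi(x)\le j(x)$ for all $x\in\mathbb{R}^d$, where $j\colon\mathbb{R}^d\to[0,\infty)$ is radial, radially non-increasing and $\int_{\mathbb{R}^d}(1\wedge|x|)\,j(x)\,dx<\infty$. Then the nonlocal mean curvature $H_\phi$ satisfies the following properties. (M) Monotonicity: if $E,F\in\mathfrak{C}$, $E\subset F$ and $x\in\partial E\cap\partial F$, then $H_\phi(x,F)\le H_\phi(x,E)$. (T) Translation invariance: if $E\in\mathfrak{C}$, $x\in\partial E$ and $z\in\mathbb{R}^d$, then $H_\phi(x,E)=H_\phi(x+z,E+z)$. (C') Uniform continuity: for any $R>0$ there exists a modulus of continuity $\omega_R$ such that for all $E\in\mathfrak{C}$ and $x\in\partial E$ such that $E$ satisfies both the interior and the exterior ball condition of radius $R$ at $x$, and for all diffeomorphisms $\Phi\colon\mathbb{R}^d\to\mathbb{R}^d$ of class $\mathcal{C}^2$ with $\Phi(y)=y$ for $|y-x|\ge1$, $$|H_\phi(x,E)-H_\phi(\Phi(x),\Phi(E))|\le\omega_R(\|\Phi-\mathrm{Id}\|_{\mathcal{C}^2}).$$ In particular, (C') implies the following weaker property. (C) Continuity: if $E_n\to E$ in $\mathfrak{C}$ and $\partial E_n\ni x_n\to x\in\partial E$, then $H_\phi(x_n,E_n)\to H_\phi(x,E)$.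
   Context: Here $d\ge2$ and $\kappa_{d-2}=\mathcal{H}^{d-2}(\mathbb{S}^{d-2})$. $\mathfrak{C}$ is the class of subsets of $\mathbb{R}^d$ that are closures of open sets with compact $\mathcal{C}^2$ boundary. $E_n\to E$ in $\mathfrak{C}$ means that there are diffeomorphisms $\Phi_n$ of $\mathbb{R}^d$ converging to the identity in $\mathcal{C}^2$ with $E_n=\Phi_n(E)$. For $E\in\mathfrak{C}$, $x\in\partial E$, $$H_\phi(x,E)=\frac1{\kappa_{d-2}}\lim_{r\downarrow0}\int_{B_r(x)^c}\widetilde\chi_E(y)\,\phi(x-y)\,dy,\qquad\widetilde\chi_E=\chi_{E^c}-\chi_E .$$ $E$ satisfies the interior (exterior) ball condition of radius $R$ at $x\in\partial E$ if there is an open ball of radius $R$ contained in $E$ (in $E^c$) whose boundary contains $x$. A modulus of continuity is a non-decreasing function $\omega\colon[0,\infty)\to[0,\infty]$ with $\omega(0)=0$ and $\lim_{s\downarrow0}\omega(s)=0$ (only small arguments are relevant). Functions are understood to be Borel measurable. *)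

theory Defs
  imports "HOL-Analysis.Analysis"
begin

section \<open>Functions and diffeomorphisms of class C2\<close>

definition deriv_blinfun ::
    "('a::real_normed_vector \<Rightarrow> 'b::real_normed_vector) \<Rightarrow> 'a \<Rightarrow> 'a \<Rightarrow>\<^sub>L 'b"
  where "deriv_blinfun f x = Blinfun (frechet_derivative f (at x))"

text \<open>Meant for open \<open>S\<close>: the derivatives are taken at \<open>x\<close> in the whole space.\<close>

definition C2_on :: "('a::real_normed_vector \<Rightarrow> 'b::real_normed_vector) \<Rightarrow> 'a set \<Rightarrow> bool"
  where "C2_on f S \<longleftrightarrow>
    (\<forall>x\<in>S. f differentiable (at x)) \<and>
    (\<forall>x\<in>S. deriv_blinfun f differentiable (at x)) \<and>
    continuous_on S (deriv_blinfun (deriv_blinfun f))"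

definition C2_diffeo :: "('a::real_normed_vector \<Rightarrow> 'a) \<Rightarrow> bool"
  where "C2_diffeo \<Phi> \<longleftrightarrow> bij \<Phi> \<and> C2_on \<Phi> UNIV \<and> C2_on (inv \<Phi>) UNIV"

text \<open>The global C2 norm, with values in \<open>[0, \<infinity>]\<close>; the derivatives are measured in the operator
  norm. It is finite if \<open>f\<close> is of class C2 and has compact support, for instance if \<open>f = \<Phi> - Id\<close> where
  \<open>\<Phi>\<close> is of class C2 and equal to the identity outside a ball; \<open>enn2real\<close> may then be applied to it.\<close>

definition C2_norm :: "('a::real_normed_vector \<Rightarrow> 'b::real_normed_vector) \<Rightarrow> ennreal"
  where "C2_norm f =
    (SUP x. ennreal (norm (f x))) +
    (SUP x. ennreal (norm (deriv_blinfun f x))) +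
    (SUP x. ennreal (norm (deriv_blinfun (deriv_blinfun f) x)))"


section \<open>The class of sets and its convergence\<close>

text \<open>Near each boundary point, \<open>U\<close> is the sublevel set of a C2 function without critical points.\<close>

definition C2_boundary :: "'a::real_normed_vector set \<Rightarrow> bool"
  where "C2_boundary U \<longleftrightarrow>
    (\<forall>x\<in>frontier U. \<exists>N (g :: 'a \<Rightarrow> real). open N \<and> x \<in> N \<and> C2_on g N \<and>
       (\<forall>y\<in>N. deriv_blinfun g y \<noteq> 0) \<and> U \<inter> N = {y\<in>N. g y < 0})"

definition C2_sets :: "'a::euclidean_space set set"
  where "C2_sets = {closure U | U. open U \<and> compact (frontier U) \<and> C2_boundary U}"

definition C2_sets_converge :: "(nat \<Rightarrow> 'a::euclidean_space set) \<Rightarrow> 'a set \<Rightarrow> bool"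
  where "C2_sets_converge En E \<longleftrightarrow>
    (\<forall>n. En n \<in> C2_sets) \<and> E \<in> C2_sets \<and>
    (\<exists>\<Phi>. (\<forall>n. C2_diffeo (\<Phi> n) \<and> En n = \<Phi> n ` E) \<and>
         (\<lambda>n. C2_norm (\<lambda>y. \<Phi> n y - y)) \<longlonglongrightarrow> 0)"

definition interior_ball_condition :: "real \<Rightarrow> 'a::euclidean_space set \<Rightarrow> 'a \<Rightarrow> bool"
  where "interior_ball_condition R E x \<longleftrightarrow> (\<exists>c. ball c R \<subseteq> E \<and> x \<in> frontier (ball c R))"

definition exterior_ball_condition :: "real \<Rightarrow> 'a::euclidean_space set \<Rightarrow> 'a \<Rightarrow> bool"
  where "exterior_ball_condition R E x \<longleftrightarrow> (\<exists>c. ball c R \<subseteq> - E \<and> x \<in> frontier (ball c R))"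


section \<open>Nonlocal mean curvature\<close>

text \<open>
  Hausdorff measure of integer dimension \<open>k\<close>, normalised to agree with Lebesgue measure on
  \<open>k\<close>-dimensional space. The empty set must be treated separately, because \<open>0 ^ 0 = 1\<close>
  (a singleton has 0-dimensional measure 1).
\<close>

definition hausdorff_measure :: "nat \<Rightarrow> 'a::metric_space set \<Rightarrow> ennreal"
  where "hausdorff_measure k A =
    (SUP \<delta>\<in>{0<..}.
       INF U\<in>{U :: nat \<Rightarrow> 'a set. A \<subseteq> (\<Union>i. U i) \<and> (\<forall>i. bounded (U i) \<and> diameter (U i) \<le> \<delta>)}.
         \<Sum>i. if U i = {} then 0
              else ennreal (unit_ball_vol (real k) * (diameter (U i) / 2) ^ k))"

text \<open>
  The constant \<open>\<kappa>\<close> with index \<open>d - 2\<close>, where \<open>d = DIM('a)\<close>. The sphere of dimension \<open>d - 2\<close> is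
  realised in \<open>'a\<close> as the unit sphere of the hyperplane orthogonal to a basis vector; all choices
  of the basis vector give isometric sets.
\<close>

definition kappa :: "'a::euclidean_space itself \<Rightarrow> real"
  where "kappa _ = enn2real (hausdorff_measure (DIM('a) - 2)
    {x :: 'a. norm x = 1 \<and> x \<bullet> (SOME b. b \<in> Basis) = 0})"

definition chi_tilde :: "'a set \<Rightarrow> 'a \<Rightarrow> real"
  where "chi_tilde E y = indicator (- E) y - indicator E y"

definition truncated_curvature :: "('a::euclidean_space \<Rightarrow> real) \<Rightarrow> 'a \<Rightarrow> 'a set \<Rightarrow> real \<Rightarrow> real"
  where "truncated_curvature \<phi> x E r = (LINT y:- ball x r|lborel. chi_tilde E y * \<phi> (x - y))"

definition nonlocal_curvature :: "('a::euclidean_space \<Rightarrow> real) \<Rightarrow> 'a \<Rightarrow> 'a set \<Rightarrow> real"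
  where "nonlocal_curvature \<phi> x E =
    1 / kappa TYPE('a) * Lim (at_right 0) (truncated_curvature \<phi> x E)"

text \<open>
  \<open>LINT\<close> and \<open>Lim\<close> are total, so that the formula above is meaningful only under this condition.
\<close>

definition nonlocal_curvature_exists :: "('a::euclidean_space \<Rightarrow> real) \<Rightarrow> 'a \<Rightarrow> 'a set \<Rightarrow> bool"
  where "nonlocal_curvature_exists \<phi> x E \<longleftrightarrow>
    (\<forall>r>0. set_integrable lborel (- ball x r) (\<lambda>y. chi_tilde E y * \<phi> (x - y))) \<and>
    (\<exists>l. (truncated_curvature \<phi> x E \<longlongrightarrow> l) (at_right 0))"

definition modulus_of_continuity :: "(real \<Rightarrow> ennreal) \<Rightarrow> bool"
  where "modulus_of_continuity \<omega> \<longleftrightarrow>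
    mono_on {0..} \<omega> \<and> \<omega> 0 = 0 \<and> (\<omega> \<longlongrightarrow> 0) (at_right 0)"

text \<open>
  \<open>r \<mapsto> j(r)\<close> is non-increasing on \<open>r > 0\<close>; no monotonicity is asked at the origin, which would
  force \<open>j\<close> to be bounded by \<open>j 0\<close> and exclude kernels that are singular at the origin.
\<close>

definition radially_nonincreasing :: "('a::real_normed_vector \<Rightarrow> real) \<Rightarrow> bool"
  where "radially_nonincreasing j \<longleftrightarrow>
    (\<forall>x y. x \<noteq> 0 \<and> norm x \<le> norm y \<longrightarrow> j y \<le> j x)"

definition radial :: "('a::real_normed_vector \<Rightarrow> real) \<Rightarrow> bool"
  where "radial j \<longleftrightarrow> (\<forall>x y. norm x = norm y \<longrightarrow> j x = j y)"

end

theory Submission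
  imports Defs
begin

text \<open>
  Since the kernel is even, the principal value may be computed with the even part of
  \<open>h \<mapsto> chi_tilde E (x + h)\<close> instead of the function itself. If the boundary of \<open>E\<close> is pinched at \<open>x\<close>
  between two spheres that touch each other there, this even part vanishes
  near the origin outside a thin region \<open>\<bar>w \<bullet> h\<bar> \<le> K \<bar>h\<bar>\<^sup>2\<close>. Such a region fills a fraction of order \<open>K \<rho>\<close>
  of the ball of radius \<open>\<rho>\<close>, and \<open>j\<close> is radially non-increasing, so that by the layer cake formula the
  integral of \<open>j\<close> over the part of the region in the ball of radius \<open>\<delta>\<close> is at most a multiple of the
  integral of \<open>\<bar>h\<bar> j h\<close> over that ball (\<open>nn_integral_thin_le\<close>). The latter tends to 0 with \<open>\<delta>\<close>. Hence
  the curvature exists as an absolutely convergent integral, and it is approximated by the truncated one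
  at a rate that depends on \<open>K\<close> only (\<open>curvature_integral_approx\<close>). Monotonicity and translation
  invariance hold for each truncated integral.

  For continuity, it remains to compare, at a fixed truncation radius, the integrals of an integrable
  function over \<open>E - x\<close> and over its image under a near isometry. There is no control on \<open>E\<close> away from
  \<open>x\<close>, so the comparison must be uniform in the set. It is (\<open>set_integral_near_isometry\<close>), because a near
  isometry moves points little and changes Lebesgue measure by a factor close to 1
  (\<open>emeasure_lipschitz_image\<close>, a consequence of the Vitali covering theorem); no Jacobians are involved.

  Finally, the two ball conditions of radius \<open>R\<close> pinch the boundary with \<open>K = 1 / (2 R)\<close>, sets with C2
  boundary are pinched locally uniformly along the boundary (\<open>C2_sets_pinched\<close>), and a diffeomorphism
  that is C2-close to the identity preserves pinching up to a change of the constants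
  (\<open>pinched_C2_image\<close>).
\<close>


section \<open>Images of sets under near isometries\<close>

text \<open>
  A bijection that distorts distances by a factor at most \<open>1 + \<epsilon>\<close> in either direction and moves no
  point by more than \<open>\<epsilon>\<close>. The condition is symmetric under passing to the inverse map. A
  diffeomorphism that is close to the identity in C1 has this property, and nothing more is used of
  it away from the point at which the curvature is taken.
\<close>
definition near_isometry :: "real \<Rightarrow> ('a::metric_space \<Rightarrow> 'a) \<Rightarrow> bool"
  where "near_isometry \<epsilon> \<Psi> \<longleftrightarrow> bij \<Psi> \<and>
    (\<forall>a b. dist (\<Psi> a) (\<Psi> b) \<le> (1 + \<epsilon>) * dist a b) \<and>
    (\<forall>a b. dist a b \<le> (1 + \<epsilon>) * dist (\<Psi> a) (\<Psi> b)) \<and>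
    (\<forall>a. dist (\<Psi> a) a \<le> \<epsilon>)"

lemma near_isometry_inv: "near_isometry \<epsilon> \<Psi> \<Longrightarrow> near_isometry \<epsilon> (inv \<Psi>)"
  unfolding near_isometry_def
  by (smt (verit) bij_imp_bij_inv bij_inv_eq_iff dist_commute)

lemma near_isometry_mono: "near_isometry \<epsilon> \<Psi> \<Longrightarrow> \<epsilon> \<le> \<delta> \<Longrightarrow> near_isometry \<delta> \<Psi>"
  unfolding near_isometry_def
  by (meson add_left_mono mult_right_mono order_trans zero_le_dist)

lemma dist_bound_imp_continuous:
  fixes f :: "'a::metric_space \<Rightarrow> 'b::metric_space"
  assumes "\<And>a b. dist (f a) (f b) \<le> L * dist a b"
  shows "continuous_on UNIV f"
proof (rule lipschitz_on_continuous_on[of "max L 0"], rule lipschitz_onI)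
  show "dist (f x) (f y) \<le> max L 0 * dist x y" for x y
    using assms[of x y] mult_right_mono[of L "max L 0" "dist x y"] by simp
qed simp

lemma near_isometry_continuous: "near_isometry \<epsilon> \<Psi> \<Longrightarrow> continuous_on UNIV \<Psi>"
  unfolding near_isometry_def using dist_bound_imp_continuous by blast

lemma borel_image:
  assumes "bij \<Psi>" "continuous_on UNIV (inv \<Psi>)" "S \<in> sets borel"
  shows "\<Psi> ` S \<in> sets borel"
proof -
  have "inv \<Psi> -` S \<inter> space borel \<in> sets borel"
    by (rule measurable_sets[OF borel_measurable_continuous_onI[OF assms(2)] assms(3)])
  then show ?thesis
    by (simp add: bij_vimage_eq_inv_image[OF bij_imp_bij_inv[OF assms(1)]] inv_inv_eq assms(1))
qed

lemma near_isometry_borel_image: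
  "near_isometry \<epsilon> \<Psi> \<Longrightarrow> S \<in> sets borel \<Longrightarrow> \<Psi> ` S \<in> sets borel"
  by (meson borel_image near_isometry_continuous near_isometry_def near_isometry_inv)

text \<open>
  The sharp constant \<open>L ^ d\<close> matters below, since it tends to 1 as \<open>L\<close> tends to 1. It comes from
  filling \<open>U\<close> by disjoint balls up to a null set: a Lipschitz map sends null sets to null sets, and it
  sends a ball of radius \<open>r\<close> into a ball of radius \<open>L r\<close>.
\<close>
lemma emeasure_lipschitz_image_open:
  fixes \<Psi> :: "'a::euclidean_space \<Rightarrow> 'a"
  assumes L: "L \<ge> 0" and lip: "\<And>a b. dist (\<Psi> a) (\<Psi> b) \<le> L * dist a b"
    and inj: "inj \<Psi>" and borel: "\<And>S. S \<in> sets borel \<Longrightarrow> \<Psi> ` S \<in> sets borel"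
    and U: "open U"
  shows "emeasure lborel (\<Psi> ` U) \<le> ennreal (L ^ DIM('a)) * emeasure lborel U"
proof -
  define K where "K = {p :: 'a \<times> real. ball (fst p) (snd p) \<subseteq> U}"
  have "\<exists>p. p \<in> K \<and> x \<in> ball (fst p) (snd p) \<and> snd p < d" if x: "x \<in> U" "0 < d" for x d
  proof -
    obtain e where "e > 0" "ball x e \<subseteq> U"
      using U x open_contains_ball by blast
    with x have "(x, min e (d/2)) \<in> K \<and> x \<in> ball x (min e (d/2)) \<and> min e (d/2) < d"
      unfolding K_def by auto
    then show ?thesis by force
  qed
  then obtain C where C: "countable C" "C \<subseteq> K"
    and dis: "pairwise (\<lambda>p q. disjnt (ball (fst p) (snd p)) (ball (fst q) (snd q))) C"
    and neg: "negligible (U - (\<Union>p\<in>C. ball (fst p) (snd p)))"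
    using Vitali_covering_theorem_balls[of U K fst snd] by blast
  define B where "B = (\<lambda>p::'a \<times> real. ball (fst p) (snd p))"
  define V where "V = (\<Union>p\<in>C. B p)"
  have V: "V \<subseteq> U" "open V"
    using C by (auto simp: V_def K_def B_def)
  have negl: "negligible (\<Psi> ` (U - V))"
    by (rule negligible_locally_Lipschitz_image)
      (use neg lip in \<open>auto simp: V_def B_def dist_norm intro!: exI[of _ UNIV]\<close>)
  have UV: "U - V \<in> sets borel"
    using U V by auto
  have null: "emeasure lborel (\<Psi> ` (U - V)) = 0"
    using negl borel[OF UV] by (simp add: negligible_iff_null_sets null_sets_completion_iff null_setsD1)
  have disB: "disjoint_family_on B C"
    using dis unfolding disjoint_family_on_def pairwise_def disjnt_def B_def by blast
  have disP: "disjoint_family_on (\<lambda>p. \<Psi> ` B p) C"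
    using disB inj unfolding disjoint_family_on_def
    by (metis image_Int image_empty)
  have le: "emeasure lborel (\<Psi> ` B p) \<le> ennreal (L ^ DIM('a)) * emeasure lborel (B p)" for p
  proof (cases "snd p > 0")
    case True
    have "\<Psi> ` B p \<subseteq> cball (\<Psi> (fst p)) (L * snd p)"
    proof (safe, simp add: B_def)
      fix y assume "dist (fst p) y < snd p"
      then show "dist (\<Psi> (fst p)) (\<Psi> y) \<le> L * snd p"
        using lip[of "fst p" y] mult_left_mono[OF less_imp_le L, of "dist (fst p) y" "snd p"] by linarith
    qed
    then have "emeasure lborel (\<Psi> ` B p) \<le> emeasure lborel (cball (\<Psi> (fst p)) (L * snd p))"
      by (rule emeasure_mono) auto
    also have "\<dots> = ennreal (L ^ DIM('a)) * emeasure lborel (B p)"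
      using True L by (simp add: emeasure_cball B_def emeasure_ball power_mult_distrib
          ennreal_mult[symmetric] mult_ac)
    finally show ?thesis .
  next
    case False
    then have "B p = {}" by (simp add: B_def)
    then show ?thesis by simp
  qed
  have "emeasure lborel (\<Psi> ` U) \<le> emeasure lborel (\<Psi> ` (U - V) \<union> \<Psi> ` V)"
    by (rule emeasure_mono) (use borel UV V in \<open>auto intro!: sets.Un borel\<close>)
  also have "\<dots> \<le> emeasure lborel (\<Psi> ` (U - V)) + emeasure lborel (\<Psi> ` V)"
    by (rule emeasure_subadditive) (use borel UV V in auto)
  also have "\<dots> = emeasure lborel (\<Union>p\<in>C. \<Psi> ` B p)"
    unfolding null by (simp add: V_def image_UN)
  also have "\<dots> = (\<integral>\<^sup>+p. emeasure lborel (\<Psi> ` B p) \<partial>count_space C)"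
    by (rule emeasure_UN_countable) (use C disP borel in \<open>auto simp: B_def\<close>)
  also have "\<dots> \<le> (\<integral>\<^sup>+p. ennreal (L ^ DIM('a)) * emeasure lborel (B p) \<partial>count_space C)"
    by (rule nn_integral_mono) (rule le)
  also have "\<dots> = ennreal (L ^ DIM('a)) * (\<integral>\<^sup>+p. emeasure lborel (B p) \<partial>count_space C)"
    by (rule nn_integral_cmult) simp
  also have "(\<integral>\<^sup>+p. emeasure lborel (B p) \<partial>count_space C) = emeasure lborel V"
    unfolding V_def by (rule emeasure_UN_countable[symmetric]) (use C disB in \<open>auto simp: B_def\<close>)
  also have "ennreal (L ^ DIM('a)) * \<dots> \<le> ennreal (L ^ DIM('a)) * emeasure lborel U"
    by (intro mult_left_mono emeasure_mono) (use V U in auto)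
  finally show ?thesis .
qed

lemma emeasure_lipschitz_image:
  fixes \<Psi> :: "'a::euclidean_space \<Rightarrow> 'a"
  assumes L: "L \<ge> 0" and lip: "\<And>a b. dist (\<Psi> a) (\<Psi> b) \<le> L * dist a b"
    and inj: "inj \<Psi>" and borel: "\<And>S. S \<in> sets borel \<Longrightarrow> \<Psi> ` S \<in> sets borel"
    and S: "S \<in> sets borel" and fin: "emeasure lborel S < \<infinity>"
  shows "emeasure lborel (\<Psi> ` S) \<le> ennreal (L ^ DIM('a)) * emeasure lborel S"
proof (rule ennreal_le_epsilon)
  fix e :: real assume e: "e > 0"
  define e' where "e' = e / (L ^ DIM('a) + 1)"
  have e': "e' > 0" "L ^ DIM('a) * e' \<le> e"
    using e L by (auto simp: e'_def divide_simps add_nonneg_pos intro!: mult_left_mono)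
  obtain U where U: "open U" "S \<subseteq> U" "emeasure lborel (U - S) < e'"
    using outer_regular_lborel[OF S e'(1)] by metis
  have "emeasure lborel U = emeasure lborel S + emeasure lborel (U - S)"
    using U S by (subst plus_emeasure) (auto simp: Un_absorb1)
  then have mU: "emeasure lborel U \<le> emeasure lborel S + e'"
    using U(3) by (simp add: add_left_mono less_imp_le)
  have "emeasure lborel (\<Psi> ` S) \<le> emeasure lborel (\<Psi> ` U)"
    by (rule emeasure_mono) (use U borel in auto)
  also have "\<dots> \<le> ennreal (L ^ DIM('a)) * emeasure lborel U"
    by (rule emeasure_lipschitz_image_open[OF L lip inj borel U(1)])
  also have "\<dots> \<le> ennreal (L ^ DIM('a)) * (emeasure lborel S + e')"
    by (intro mult_left_mono mU) simp
  also have "\<dots> = ennreal (L ^ DIM('a)) * emeasure lborel S + ennreal (L ^ DIM('a) * e')"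
    using L e' by (simp add: distrib_left ennreal_mult)
  also have "\<dots> \<le> ennreal (L ^ DIM('a)) * emeasure lborel S + ennreal e"
    by (intro add_left_mono ennreal_leI e')
  finally show "emeasure lborel (\<Psi> ` S) \<le> ennreal (L ^ DIM('a)) * emeasure lborel S + ennreal e" .
qed

lemma measure_near_isometry_image:
  fixes \<Psi> :: "'a::euclidean_space \<Rightarrow> 'a"
  assumes \<Psi>: "near_isometry \<epsilon> \<Psi>" "\<epsilon> \<ge> 0" and S: "S \<in> sets borel" "emeasure lborel S < \<infinity>"
  shows "measure lborel (\<Psi> ` S) \<le> (1 + \<epsilon>) ^ DIM('a) * measure lborel S"
proof -
  have *: "emeasure lborel (\<Psi> ` S) \<le> ennreal ((1 + \<epsilon>) ^ DIM('a)) * emeasure lborel S"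
    by (rule emeasure_lipschitz_image)
      (use assms near_isometry_borel_image[OF \<Psi>(1)] in \<open>auto simp: near_isometry_def bij_is_inj\<close>)
  also have "\<dots> < \<infinity>"
    using S by (simp add: ennreal_mult_less_top)
  finally have fin: "emeasure lborel (\<Psi> ` S) < \<infinity>" .
  from * fin S \<Psi>(2) show "measure lborel (\<Psi> ` S) \<le> (1 + \<epsilon>) ^ DIM('a) * measure lborel S"
    by (simp add: emeasure_eq_ennreal_measure ennreal_mult[symmetric] less_top[symmetric])
qed

text \<open>
  The estimate is uniform in \<open>B\<close>, which may oscillate at an arbitrarily small scale. Enclose \<open>A\<close> in
  an open set \<open>U\<close> of almost the same measure and keep only the points of \<open>A\<close> at distance at least
  \<open>1 / (n + 1)\<close> from the complement of \<open>U\<close>: a near isometry with small \<open>\<epsilon>\<close> maps them into \<open>U\<close>, and it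
  changes the measure of no set by more than the factor \<open>(1 + \<epsilon>) ^ d\<close>.
\<close>
lemma measure_Int_image_le:
  fixes A :: "'a::euclidean_space set"
  assumes A: "A \<in> sets borel" "emeasure lborel A < \<infinity>" and \<eta>: "\<eta> > 0"
  obtains \<epsilon> where "\<epsilon> > 0"
    "\<And>B \<Psi>. B \<in> sets borel \<Longrightarrow> near_isometry \<epsilon> \<Psi> \<Longrightarrow>
      measure lborel (B \<inter> A) \<le> measure lborel (\<Psi> ` B \<inter> A) + \<eta>"
proof -
  define m where "m = measure lborel A"
  have m0: "m \<ge> 0" by (simp add: m_def)
  obtain U where U: "open U" "A \<subseteq> U" "emeasure lborel (U - A) < ennreal (\<eta> / 4)"
    using outer_regular_lborel[OF A(1), of "\<eta>/4"] \<eta> by auto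
  have finU: "emeasure lborel U < \<infinity>"
  proof -
    have "emeasure lborel U = emeasure lborel A + emeasure lborel (U - A)"
      using U A by (subst plus_emeasure) (auto simp: Un_absorb1)
    also have "\<dots> < \<infinity>"
      using A U(3) by (auto simp: ennreal_add_less_top) (use order.strict_trans in fastforce)
    finally show ?thesis .
  qed
  define C where "C = (\<lambda>n. A \<inter> {a. ball a (1 / real (Suc n)) \<subseteq> U})"
  have closed: "closed {a. ball a r \<subseteq> U}" for r
  proof -
    have "- {a. ball a r \<subseteq> U} = (\<Union>y\<in>-U. ball y r)"
      by (auto simp: dist_commute)
    then show ?thesis
      by (metis closed_def open_UN open_ball)
  qed
  have Cb: "C n \<in> sets borel" for n
    unfolding C_def using closed A by auto
  have "(\<lambda>n. measure lborel (C n)) \<longlonglongrightarrow> measure lborel (\<Union>n. C n)"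
  proof (rule Lim_measure_incseq)
    show "range C \<subseteq> sets lborel" using Cb by auto
    show "incseq C"
    proof (intro monoI, unfold C_def, safe)
      fix i j :: nat and a y assume "i \<le> j" and sub: "ball a (1 / real (Suc i)) \<subseteq> U" and "y \<in> ball a (1 / real (Suc j))"
      then have "ball a (1 / real (Suc j)) \<subseteq> ball a (1 / real (Suc i))"
        by (intro subset_ball) (simp add: frac_le)
      then show "y \<in> U"
        using sub \<open>y \<in> ball a (1 / real (Suc j))\<close> by blast
    qed
    show "emeasure lborel (\<Union>n. C n) \<noteq> \<infinity>"
      using A(2) emeasure_mono[of "\<Union>n. C n" A lborel] A(1) unfolding C_def
      by (auto simp: top_unique)
  qed
  also have "(\<Union>n. C n) = A"
  proof
    show "A \<subseteq> (\<Union>n. C n)"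
    proof
      fix a assume "a \<in> A"
      then obtain e where e: "e > 0" "ball a e \<subseteq> U"
        using U open_contains_ball by blast
      obtain n where "1 / real (Suc n) < e"
        using e nat_approx_posE by blast
      then have "ball a (1 / real (Suc n)) \<subseteq> U"
        using e subset_ball[of "1 / real (Suc n)" e a] by force
      with \<open>a \<in> A\<close> show "a \<in> (\<Union>n. C n)"
        by (auto simp: C_def)
    qed
  qed (auto simp: C_def)
  finally have "\<forall>\<^sub>F n in sequentially. measure lborel (C n) > m - \<eta> / 4"
    using order_tendstoD(1)[of _ "measure lborel A"] \<eta> m_def by fastforce
  then obtain n where n: "measure lborel (C n) > m - \<eta> / 4"
    by (auto simp: eventually_sequentially)
  have "((\<lambda>\<epsilon>. (1 + \<epsilon>) ^ DIM('a)) \<longlongrightarrow> (1 + 0) ^ DIM('a)) (at_right (0::real))"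
    by (intro tendsto_intros)
  moreover have "1 < 1 + min 1 (\<eta> / 4 / (m + 1))"
    using \<eta> m0 by simp
  ultimately have "\<forall>\<^sub>F \<epsilon> in at_right 0. (1 + \<epsilon>) ^ DIM('a) < 1 + min 1 (\<eta> / 4 / (m + 1))"
    by (intro order_tendstoD(2)[where y="(1+0)^DIM('a)"]) auto
  moreover have "\<forall>\<^sub>F \<epsilon> in at_right 0. \<epsilon> < 1 / real (Suc n)"
    by (rule order_tendstoD(2)[OF tendsto_ident_at]) simp
  moreover have "\<forall>\<^sub>F \<epsilon> in at_right (0::real). 0 < \<epsilon>"
    by (simp add: eventually_at_right_less)
  ultimately have "\<forall>\<^sub>F \<epsilon> in at_right 0. (1 + \<epsilon>) ^ DIM('a) < 1 + min 1 (\<eta> / 4 / (m + 1)) \<and>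
    \<epsilon> < 1 / real (Suc n) \<and> 0 < \<epsilon>"
    by eventually_elim auto
  then obtain \<epsilon> where \<epsilon>: "(1 + \<epsilon>) ^ DIM('a) < 1 + min 1 (\<eta> / 4 / (m + 1))" "\<epsilon> < 1 / real (Suc n)" "\<epsilon> > 0"
    using eventually_happens'[OF trivial_limit_at_right_real] by blast
  define D where "D = (1 + \<epsilon>) ^ DIM('a)"
  have D: "1 \<le> D" "D \<le> 2" "(D - 1) * m \<le> \<eta> / 4"
  proof -
    show "1 \<le> D" using \<epsilon> by (simp add: D_def)
    show "D \<le> 2" using \<epsilon>(1) by (simp add: D_def)
    have "D - 1 \<le> \<eta> / 4 / (m + 1)"
      using \<epsilon>(1) by (simp add: D_def)
    then have "(D - 1) * (m + 1) \<le> \<eta> / 4"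
      using m0 pos_le_divide_eq[of "m + 1" "D - 1" "\<eta> / 4"] by linarith
    moreover have "(D - 1) * m \<le> (D - 1) * (m + 1)"
      using \<open>1 \<le> D\<close> by (intro mult_left_mono) auto
    ultimately show "(D - 1) * m \<le> \<eta> / 4" by linarith
  qed
  show thesis
  proof
    show "\<epsilon> > 0" by fact
    fix B :: "'a set" and \<Psi> :: "'a \<Rightarrow> 'a" assume B: "B \<in> sets borel" and \<Psi>: "near_isometry \<epsilon> \<Psi>"
    have \<Psi>': "near_isometry \<epsilon> (inv \<Psi>)" and bij: "bij \<Psi>"
      using \<Psi> near_isometry_inv by (auto simp: near_isometry_def)
    have mono: "measure lborel X \<le> measure lborel Y"
      if "X \<subseteq> Y" "X \<in> sets borel" "Y \<in> sets borel" "emeasure lborel Y < \<infinity>" for X Y :: "'a set"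
      using that by (intro measure_mono_fmeasurable) (auto simp: fmeasurable_def)
    have fin: "emeasure lborel Y < \<infinity>" if "Y \<subseteq> U" for Y :: "'a set"
      using that finU U(1) emeasure_mono[of Y U lborel] by (auto simp: less_top[symmetric] top_unique)
    note [simp] = near_isometry_borel_image[OF \<Psi> B]
    have img: "\<Psi> ` (B \<inter> C n) \<in> sets borel"
      using B Cb near_isometry_borel_image[OF \<Psi>] by auto
    have sub: "\<Psi> ` (B \<inter> C n) \<subseteq> U \<inter> \<Psi> ` B"
    proof
      fix y assume "y \<in> \<Psi> ` (B \<inter> C n)"
      then obtain a where a: "a \<in> B" "a \<in> C n" "y = \<Psi> a" by blast
      have "dist a y < 1 / real (Suc n)"
        using \<Psi> a \<epsilon>(2) by (auto simp: near_isometry_def dist_commute intro: le_less_trans)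
      then have "y \<in> U"
        using a by (auto simp: C_def)
      then show "y \<in> U \<inter> \<Psi> ` B"
        using a by auto
    qed
    have "B \<inter> C n = inv \<Psi> ` (\<Psi> ` (B \<inter> C n))"
      using bij by (simp add: image_inv_f_f bij_is_inj)
    then have "measure lborel (B \<inter> C n) \<le> D * measure lborel (\<Psi> ` (B \<inter> C n))"
      unfolding D_def using measure_near_isometry_image[OF \<Psi>' _ img] \<epsilon>(3) fin[of "\<Psi> ` (B \<inter> C n)"] sub by auto
    also have "\<dots> \<le> D * measure lborel (U \<inter> \<Psi> ` B)"
      by (intro mult_left_mono mono fin sub img) (use D U in auto)
    also have "measure lborel (U \<inter> \<Psi> ` B) \<le> measure lborel (\<Psi> ` B \<inter> A) + measure lborel (U - A)"
    proof -
      have "measure lborel (U \<inter> \<Psi> ` B) \<le> measure lborel ((\<Psi> ` B \<inter> A) \<union> (U - A))"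
        by (intro mono fin) (use U A in \<open>auto intro!: sets.Un sets.Int sets.Diff\<close>)
      also have "\<dots> \<le> measure lborel (\<Psi> ` B \<inter> A) + measure lborel (U - A)"
        by (intro measure_Un_le) (use U A in auto)
      finally show ?thesis .
    qed
    also have "measure lborel (U - A) \<le> \<eta> / 4"
      using U(3) \<eta> fin[of "U - A"] by (simp add: emeasure_eq_ennreal_measure less_top ennreal_less_iff)
    finally have 1: "measure lborel (B \<inter> C n) \<le> D * (measure lborel (\<Psi> ` B \<inter> A) + \<eta> / 4)"
      using D by (simp add: mult_left_mono)
    have "measure lborel (\<Psi> ` B \<inter> A) \<le> m"
      unfolding m_def by (intro mono) (use A in auto)
    then have "(D - 1) * measure lborel (\<Psi> ` B \<inter> A) \<le> (D - 1) * m"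
      by (intro mult_left_mono) (use D in auto)
    then have 2: "D * measure lborel (\<Psi> ` B \<inter> A) \<le> measure lborel (\<Psi> ` B \<inter> A) + \<eta> / 4"
      using D(3) by (simp add: algebra_simps)
    have "measure lborel (B \<inter> A) \<le> measure lborel (B \<inter> C n \<union> (A - C n))"
      by (intro mono fin) (use B Cb A U in \<open>auto simp: C_def\<close>)
    also have "\<dots> \<le> measure lborel (B \<inter> C n) + measure lborel (A - C n)"
      by (intro measure_Un_le) (use B Cb A in auto)
    also have "measure lborel (A - C n) = m - measure lborel (C n)"
      unfolding m_def by (intro measure_Diff) (use A Cb in \<open>auto simp: C_def less_top\<close>)
    also have "\<dots> \<le> \<eta> / 4" using n by simp
    finally have "measure lborel (B \<inter> A) \<le> measure lborel (B \<inter> C n) + \<eta> / 4" by simp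
    moreover have "D * (\<eta> / 4) \<le> \<eta> / 2"
      using mult_right_mono[OF D(2), of "\<eta> / 4"] \<eta> by simp
    ultimately show "measure lborel (B \<inter> A) \<le> measure lborel (\<Psi> ` B \<inter> A) + \<eta>"
      using 1 2 by (simp add: algebra_simps)
  qed
qed

lemma integrable_imp_set_integrable:
  fixes f :: "'a::euclidean_space \<Rightarrow> real"
  shows "integrable lborel f \<Longrightarrow> X \<in> sets borel \<Longrightarrow> set_integrable lborel X f"
  using integrable_mult_indicator[of X lborel f] by (simp add: set_integrable_def)

text \<open>
  Stability of the integral over a set under near isometries of the set, uniformly in the set. By
  density in L1, this reduces to the indicator function \<open>f\<close> of a set \<open>A\<close> of finite measure; there
  \<open>measure_Int_image_le\<close>, applied to the map and to its inverse, gives both inequalities.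
\<close>
lemma set_integral_near_isometry:
  fixes f :: "'a::euclidean_space \<Rightarrow> real"
  assumes f: "integrable lborel f" and \<eta>: "\<eta> > 0"
  shows "\<exists>\<epsilon>>0. \<forall>B \<Psi>. B \<in> sets borel \<and> near_isometry \<epsilon> \<Psi> \<longrightarrow>
    \<bar>(LINT h:B|lborel. f h) - (LINT h:\<Psi> ` B|lborel. f h)\<bar> \<le> \<eta>"
  using f \<eta>
proof (induction arbitrary: \<eta> rule: integrable_induct)
  case (base A c)
  define e where "e = \<eta> / (\<bar>c\<bar> + 1)"
  have e: "e > 0" "e * \<bar>c\<bar> \<le> \<eta>"
    using base by (auto simp: e_def divide_simps add_nonneg_pos intro!: mult_left_mono)
  have A: "A \<in> sets borel" using base by simp
  obtain \<epsilon> where \<epsilon>: "\<epsilon> > 0"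
    "\<And>B \<Psi>. B \<in> sets borel \<Longrightarrow> near_isometry \<epsilon> \<Psi> \<Longrightarrow>
      measure lborel (B \<inter> A) \<le> measure lborel (\<Psi> ` B \<inter> A) + e"
    using measure_Int_image_le[OF A base(2) e(1)] by metis
  have int: "(LINT h:B|lborel. indicator A h *\<^sub>R c) = measure lborel (B \<inter> A) * c" if "B \<in> sets borel" for B
  proof -
    have "(LINT h:B|lborel. indicator A h *\<^sub>R c) = (LINT h|lborel. indicator (B \<inter> A) h *\<^sub>R c)"
      unfolding set_lebesgue_integral_def by (simp add: indicator_inter_arith mult.assoc)
    also have "\<dots> = measure lborel (B \<inter> A) * c"
      using base that emeasure_mono[of "B \<inter> A" A lborel]
      by (simp add: le_less_trans)
    finally show ?thesis .
  qed
  show ?case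
  proof (intro exI[of _ \<epsilon>] conjI allI impI)
    fix B :: "'a set" and \<Psi> :: "'a \<Rightarrow> 'a" assume *: "B \<in> sets borel \<and> near_isometry \<epsilon> \<Psi>"
    then have PB: "\<Psi> ` B \<in> sets borel"
      using near_isometry_borel_image by blast
    have "inv \<Psi> ` \<Psi> ` B = B"
      using * by (simp add: near_isometry_def image_inv_f_f bij_is_inj)
    then have "\<bar>measure lborel (B \<inter> A) - measure lborel (\<Psi> ` B \<inter> A)\<bar> \<le> e"
      using \<epsilon>(2)[of B \<Psi>] \<epsilon>(2)[OF PB near_isometry_inv[of \<epsilon> \<Psi>]] * by simp
    then have "\<bar>measure lborel (B \<inter> A) - measure lborel (\<Psi> ` B \<inter> A)\<bar> * \<bar>c\<bar> \<le> e * \<bar>c\<bar>"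
      by (intro mult_right_mono) auto
    then show "\<bar>(LINT h:B|lborel. indicator A h *\<^sub>R c) - (LINT h:\<Psi> ` B|lborel. indicator A h *\<^sub>R c)\<bar> \<le> \<eta>"
      using * e PB by (simp only: int) (simp add: left_diff_distrib[symmetric] abs_mult)
  qed (use \<epsilon> in auto)
next
  case (add f g)
  obtain e1 where e1: "e1 > 0" "\<And>B \<Psi>. B \<in> sets borel \<Longrightarrow> near_isometry e1 \<Psi> \<Longrightarrow>
    \<bar>(LINT h:B|lborel. f h) - (LINT h:\<Psi> ` B|lborel. f h)\<bar> \<le> \<eta> / 2"
    using add.IH(1)[of "\<eta>/2"] add.prems by auto
  obtain e2 where e2: "e2 > 0" "\<And>B \<Psi>. B \<in> sets borel \<Longrightarrow> near_isometry e2 \<Psi> \<Longrightarrow>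
    \<bar>(LINT h:B|lborel. g h) - (LINT h:\<Psi> ` B|lborel. g h)\<bar> \<le> \<eta> / 2"
    using add.IH(2)[of "\<eta>/2"] add.prems by auto
  show ?case
  proof (intro exI[of _ "min e1 e2"] conjI allI impI)
    fix B :: "'a set" and \<Psi> :: "'a \<Rightarrow> 'a" assume *: "B \<in> sets borel \<and> near_isometry (min e1 e2) \<Psi>"
    then have PB: "\<Psi> ` B \<in> sets borel"
      using near_isometry_borel_image by blast
    have si: "set_integrable lborel X f" "set_integrable lborel X g" if "X \<in> sets borel" for X
      using integrable_imp_set_integrable[OF _ that] add.hyps by blast+
    have "near_isometry e1 \<Psi>" "near_isometry e2 \<Psi>"
      using * near_isometry_mono[of "min e1 e2" \<Psi>] by auto
    moreover have "(LINT h:X|lborel. f h + g h) = (LINT h:X|lborel. f h) + (LINT h:X|lborel. g h)"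
      if "X \<in> sets borel" for X
      using si[OF that] by simp
    ultimately show "\<bar>(LINT h:B|lborel. f h + g h) - (LINT h:\<Psi> ` B|lborel. f h + g h)\<bar> \<le> \<eta>"
      using e1(2)[of B \<Psi>] e2(2)[of B \<Psi>] * PB by (smt (verit) field_sum_of_halves)
  qed (use e1 e2 in auto)
next
  case (lim f s)
  have bd: "norm (s i h) \<le> 2 * norm (f h)" for i h
    using lim by simp
  have "(\<lambda>i. LINT h|lborel. \<bar>s i h - f h\<bar>) \<longlonglongrightarrow> (LINT h|(lborel::'a measure). (0::real))"
  proof (rule integral_dominated_convergence)
    show "integrable lborel (\<lambda>h. 3 * \<bar>f h\<bar>)"
      using lim by auto
    show "AE h in lborel. (\<lambda>i. \<bar>s i h - f h\<bar>) \<longlonglongrightarrow> 0"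
      using lim by (intro AE_I2 tendsto_rabs_zero LIM_zero) auto
    show "AE h in lborel. norm \<bar>s i h - f h\<bar> \<le> 3 * \<bar>f h\<bar>" for i
    proof (intro AE_I2)
      fix h show "norm \<bar>s i h - f h\<bar> \<le> 3 * \<bar>f h\<bar>"
        using bd[of i h] by simp
    qed
  qed (use lim in auto)
  then have "\<forall>\<^sub>F i in sequentially. (LINT h|lborel. \<bar>s i h - f h\<bar>) < \<eta> / 3"
    using lim.prems by (intro order_tendstoD(2)) auto
  then obtain i where i: "(LINT h|lborel. \<bar>s i h - f h\<bar>) < \<eta> / 3"
    by (auto simp: eventually_sequentially)
  obtain e where e: "e > 0" "\<And>B \<Psi>. B \<in> sets borel \<Longrightarrow> near_isometry e \<Psi> \<Longrightarrow>
    \<bar>(LINT h:B|lborel. s i h) - (LINT h:\<Psi> ` B|lborel. s i h)\<bar> \<le> \<eta> / 3"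
    using lim.IH[of "\<eta>/3" i] lim.prems by auto
  have diff: "\<bar>(LINT h:X|lborel. s i h) - (LINT h:X|lborel. f h)\<bar> \<le> \<eta> / 3" if X: "X \<in> sets borel" for X
  proof -
    have si: "set_integrable lborel X f" "set_integrable lborel X (s i)"
      using integrable_imp_set_integrable[OF _ X] lim.hyps by blast+
    have "\<bar>(LINT h:X|lborel. s i h) - (LINT h:X|lborel. f h)\<bar> = \<bar>LINT h:X|lborel. s i h - f h\<bar>"
      by (simp add: si)
    also have "\<dots> \<le> (LINT h|lborel. \<bar>indicator X h * (s i h - f h)\<bar>)"
      unfolding set_lebesgue_integral_def by simp
    also have "\<dots> \<le> (LINT h|lborel. \<bar>s i h - f h\<bar>)"
      using lim si X by (intro integral_mono integrable_abs)
        (auto simp: indicator_def set_integrable_def right_diff_distrib)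
    finally show ?thesis using i by simp
  qed
  show ?case
  proof (intro exI[of _ e] conjI allI impI)
    fix B :: "'a set" and \<Psi> :: "'a \<Rightarrow> 'a" assume *: "B \<in> sets borel \<and> near_isometry e \<Psi>"
    then have PB: "\<Psi> ` B \<in> sets borel"
      using near_isometry_borel_image by blast
    show "\<bar>(LINT h:B|lborel. f h) - (LINT h:\<Psi> ` B|lborel. f h)\<bar> \<le> \<eta>"
      using e(2)[OF conjunct1[OF *] conjunct2[OF *]] diff[OF conjunct1[OF *]] diff[OF PB] by linarith
  qed (use e in auto)
qed


section \<open>Integrals of radially non-increasing functions over thin regions\<close>

text \<open>
  Layer cake: up to the origin and up to a sphere, a superlevel set of \<open>j\<close> is empty, a ball centred
  at the origin or the whole space; in the last case, a ball outside which \<open>f\<close> vanishes takes its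
  place. Hence an inequality between the integrals of \<open>f\<close> and \<open>g\<close> over all such balls passes to the
  integrals against \<open>j\<close>.
\<close>
lemma nn_integral_radial_mono:
  fixes j :: "'a::euclidean_space \<Rightarrow> real" and f g :: "'a \<Rightarrow> ennreal"
  assumes [measurable]: "j \<in> borel_measurable borel" "f \<in> borel_measurable borel" "g \<in> borel_measurable borel"
    and j: "\<And>h. j h \<ge> 0" "radially_nonincreasing j"
    and \<delta>: "\<delta> > 0" and supp: "\<And>h. norm h \<ge> \<delta> \<Longrightarrow> f h = 0"
    and le: "\<And>\<rho>. \<rho> > 0 \<Longrightarrow> (\<integral>\<^sup>+h. f h * indicator (ball 0 \<rho>) h \<partial>lborel) \<le> (\<integral>\<^sup>+h. g h * indicator (ball 0 \<rho>) h \<partial>lborel)"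
  shows "(\<integral>\<^sup>+h. f h * ennreal (j h) \<partial>lborel) \<le> (\<integral>\<^sup>+h. g h * ennreal (j h) \<partial>lborel)"
proof -
  have level: "(\<integral>\<^sup>+h. f h * indicator {h. t < j h} h \<partial>lborel) \<le> (\<integral>\<^sup>+h. g h * indicator {h. t < j h} h \<partial>lborel)"
    for t
  proof (cases "{h. t < j h} \<subseteq> {0}")
    case True
    have "AE h in lborel. h \<noteq> (0::'a)"
      by (rule AE_lborel_singleton)
    then have "AE h in lborel. f h * indicator {h. t < j h} h = 0"
      by eventually_elim (use True in \<open>force simp: indicator_def\<close>)
    then have "(\<integral>\<^sup>+h. f h * indicator {h. t < j h} h \<partial>lborel) = (\<integral>\<^sup>+h. 0 \<partial>(lborel::'a measure))"
      by (rule nn_integral_cong_AE)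
    then show ?thesis by simp
  next
    case False
    then obtain l0 where l0: "l0 \<noteq> 0" "t < j l0" by auto
    have down: "t < j h" if "h \<noteq> 0" "norm h \<le> norm l" "t < j l" for h l
      using j(2) that unfolding radially_nonincreasing_def by (meson less_le_trans)
    obtain \<rho> where \<rho>: "\<rho> > 0" "\<And>h. t < j h \<Longrightarrow> norm h < \<delta> \<Longrightarrow> norm h \<le> \<rho>"
      "\<And>h. h \<noteq> 0 \<Longrightarrow> norm h < \<rho> \<Longrightarrow> t < j h"
    proof (cases "\<forall>h. h \<noteq> 0 \<and> norm h < \<delta> \<longrightarrow> t < j h")
      case True
      then show ?thesis using \<delta> by (intro that[of \<delta>]) auto
    next
      case False
      then obtain b where b: "b \<noteq> 0" "norm b < \<delta>" "\<not> t < j b" by blast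
      define S where "S = norm ` {h. h \<noteq> 0 \<and> t < j h}"
      have "x \<le> norm b" if "x \<in> S" for x
        using that down[OF b(1)] b(3) unfolding S_def by (metis (mono_tags, lifting) imageE linear mem_Collect_eq)
      then have bdd: "bdd_above S"
        by (auto simp: bdd_above_def)
      have ne: "norm l0 \<in> S"
        using l0 by (auto simp: S_def)
      show ?thesis
      proof (rule that[of "Sup S"])
        have "0 < norm l0" using l0 by simp
        also have "\<dots> \<le> Sup S" using ne bdd by (rule cSup_upper)
        finally show pos: "Sup S > 0" .
        show "norm h \<le> Sup S" if "t < j h" for h
        proof (cases "h = 0")
          case False
          then show ?thesis using that bdd by (intro cSup_upper) (auto simp: S_def)
        qed (use pos in simp)
        show "t < j h" if h: "h \<noteq> 0" "norm h < Sup S" for h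
        proof -
          obtain x where "x \<in> S" "norm h < x"
            using h(2) ne less_cSup_iff[OF _ bdd, of "norm h"] by blast
          then show ?thesis using h(1) down[of h] unfolding S_def by (metis (mono_tags, lifting) imageE less_imp_le mem_Collect_eq)
        qed
      qed
    qed
    have "AE h in lborel. h \<noteq> (0::'a)"
      by (rule AE_lborel_singleton)
    moreover have "AE h in lborel. h \<notin> sphere (0::'a) \<rho>"
      using negligible_sphere[of "0::'a" \<rho>]
      by (intro AE_not_in) (simp add: negligible_iff_null_sets null_sets_completion_iff)
    ultimately have ae: "AE h in lborel. f h * indicator {h. t < j h} h \<le> f h * indicator (ball 0 \<rho>) h \<and>
       g h * indicator (ball 0 \<rho>) h \<le> g h * indicator {h. t < j h} h"
    proof eventually_elim
      case (elim h)
      have "f h * indicator {h. t < j h} h \<le> f h * indicator (ball 0 \<rho>) h"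
      proof (cases "norm h < \<delta>")
        case True
        then show ?thesis using \<rho>(2)[of h] elim by (auto simp: indicator_def dist_norm split: if_splits)
      qed (use supp in auto)
      then show ?case
        using \<rho>(3)[of h] elim by (auto simp: indicator_def)
    qed
    have "(\<integral>\<^sup>+h. f h * indicator {h. t < j h} h \<partial>lborel) \<le> (\<integral>\<^sup>+h. f h * indicator (ball 0 \<rho>) h \<partial>lborel)"
      using ae by (intro nn_integral_mono_AE) auto
    also have "\<dots> \<le> (\<integral>\<^sup>+h. g h * indicator (ball 0 \<rho>) h \<partial>lborel)"
      by (rule le) fact
    also have "\<dots> \<le> (\<integral>\<^sup>+h. g h * indicator {h. t < j h} h \<partial>lborel)"
      using ae by (intro nn_integral_mono_AE) auto
    finally show ?thesis .
  qed
  \<comment> \<open>Tonelli, with \<open>j h\<close> written as the integral over \<open>t \<ge> 0\<close> of the indicator of \<open>t < j h\<close>.\<close>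
  have cake: "(\<integral>\<^sup>+h. q h * ennreal (j h) \<partial>lborel) =
      (\<integral>\<^sup>+t. indicator {0..} t * (\<integral>\<^sup>+h. q h * indicator {h. t < j h} h \<partial>lborel) \<partial>(lborel::real measure))"
    if [measurable]: "q \<in> borel_measurable borel" for q :: "'a \<Rightarrow> ennreal"
  proof -
    have [measurable]: "{h. t < j h} \<in> sets borel" for t
      by measurable
    have "(\<integral>\<^sup>+h. q h * ennreal (j h) \<partial>lborel) =
      (\<integral>\<^sup>+h. \<integral>\<^sup>+t. q h * (if 0 \<le> t \<and> t < j h then 1 else 0) \<partial>(lborel::real measure) \<partial>lborel)"
    proof (rule nn_integral_cong)
      fix h
      have "(\<integral>\<^sup>+t. q h * (if 0 \<le> t \<and> t < j h then 1 else 0) \<partial>(lborel::real measure)) =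
        q h * (\<integral>\<^sup>+t. indicator {0..<j h} t \<partial>lborel)"
        by (subst nn_integral_cmult[symmetric]) (auto intro!: nn_integral_cong simp: indicator_def)
      then show "q h * ennreal (j h) = (\<integral>\<^sup>+t. q h * (if 0 \<le> t \<and> t < j h then 1 else 0) \<partial>(lborel::real measure))"
        using j(1)[of h] by simp
    qed
    also have "\<dots> = (\<integral>\<^sup>+t. \<integral>\<^sup>+h. q h * (if 0 \<le> t \<and> t < j h then 1 else 0) \<partial>lborel \<partial>(lborel::real measure))"
      by (rule lborel_pair.Fubini'[symmetric]) measurable
    also have "\<dots> = (\<integral>\<^sup>+t. indicator {0..} t * (\<integral>\<^sup>+h. q h * indicator {h. t < j h} h \<partial>lborel) \<partial>(lborel::real measure))"
      by (subst nn_integral_cmult[symmetric]) (auto intro!: nn_integral_cong simp: indicator_def)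
    finally show ?thesis .
  qed
  show ?thesis
    by (simp add: cake del: nn_integral_indicator) (intro nn_integral_mono mult_left_mono level, simp)
qed

lemma emeasure_lborel_translate:
  fixes S :: "'a::euclidean_space set"
  assumes "S \<in> sets borel"
  shows "emeasure lborel {h. h - c \<in> S} = emeasure lborel S"
proof -
  have "emeasure lborel S = emeasure (distr lborel borel ((+) (- c))) S"
    by (simp add: lborel_distr_plus)
  also have "\<dots> = emeasure lborel ((+) (- c) -` S \<inter> space lborel)"
    by (rule emeasure_distr) (use assms in auto)
  also have "(+) (- c) -` S \<inter> space lborel = {h. h - c \<in> S}"
    by auto
  finally show ?thesis by simp
qed

text \<open>
  Translates of the slab by multiples of \<open>3 t w\<close> are disjoint, and \<open>n\<close> of them fit into the ball of
  twice the radius. This bounds the measure of the slab without rotating it to a coordinate direction.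
\<close>
lemma emeasure_slab_le:
  fixes w :: "'a::euclidean_space"
  assumes w: "norm w = 1" and t: "t > 0" "real n * (3 * t) \<le> \<rho>"
  shows "of_nat n * emeasure lborel {h \<in> ball 0 \<rho>. \<bar>w \<bullet> h\<bar> \<le> t} \<le> emeasure lborel (ball (0::'a) (2 * \<rho>))"
proof -
  define S where "S = {h \<in> ball 0 \<rho>. \<bar>w \<bullet> h\<bar> \<le> t}"
  have S: "S \<in> sets borel"
    unfolding S_def by measurable
  define T where "T = (\<lambda>i::nat. {h. h - (3 * t * real i) *\<^sub>R w \<in> S})"
  have T: "T i \<in> sets borel" for i
  proof -
    have "(\<lambda>h. h - (3 * t * real i) *\<^sub>R w) -` S \<inter> space borel \<in> sets borel"
      by (rule measurable_sets[OF _ S]) measurable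
    then show ?thesis by (simp add: T_def vimage_def)
  qed
  have inner: "\<bar>w \<bullet> h - 3 * t * real i\<bar> \<le> t" if "h \<in> T i" for h i
    using that w by (simp add: T_def S_def inner_diff_right dot_square_norm)
  have dis: "disjoint_family_on T {..<n}"
  proof (unfold disjoint_family_on_def, intro ballI impI)
    fix i k assume ik: "i \<in> {..<n}" "k \<in> {..<n}" "i \<noteq> k"
    show "T i \<inter> T k = {}"
    proof (rule ccontr)
      assume "T i \<inter> T k \<noteq> {}"
      then obtain h where "h \<in> T i" "h \<in> T k" by blast
      then have "\<bar>3 * t * real i - 3 * t * real k\<bar> \<le> 2 * t"
        using inner[of h i] inner[of h k] by linarith
      moreover have "\<bar>3 * t * real i - 3 * t * real k\<bar> = 3 * t * \<bar>real i - real k\<bar>"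
        using t by (simp add: right_diff_distrib[symmetric] abs_mult)
      moreover have "\<bar>real i - real k\<bar> \<ge> 1"
        using ik by linarith
      then have "3 * t * \<bar>real i - real k\<bar> \<ge> 3 * t * 1"
        using t by (intro mult_left_mono) auto
      ultimately show False using t by linarith
    qed
  qed
  have sub: "(\<Union>i\<in>{..<n}. T i) \<subseteq> ball 0 (2 * \<rho>)"
  proof safe
    fix i h assume i: "i < n" and h: "h \<in> T i"
    have "norm h \<le> norm (h - (3 * t * real i) *\<^sub>R w) + norm ((3 * t * real i) *\<^sub>R w)"
      by (metis diff_add_cancel norm_triangle_ineq)
    also have "norm (h - (3 * t * real i) *\<^sub>R w) < \<rho>"
      using h by (simp add: T_def S_def)
    also have "norm ((3 * t * real i) *\<^sub>R w) = 3 * t * real i"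
      using w t by simp
    also have "\<dots> \<le> real n * (3 * t)"
      using i t by simp
    also have "\<dots> \<le> \<rho>" by fact
    finally show "h \<in> ball 0 (2 * \<rho>)" by simp
  qed
  have "of_nat n * emeasure lborel S = (\<Sum>i<n. emeasure lborel (T i))"
    unfolding T_def by (simp add: emeasure_lborel_translate[OF S])
  also have "\<dots> = emeasure lborel (\<Union>i\<in>{..<n}. T i)"
    by (rule sum_emeasure) (use T dis in auto)
  also have "\<dots> \<le> emeasure lborel (ball (0::'a) (2 * \<rho>))"
    by (rule emeasure_mono[OF sub]) auto
  finally show ?thesis unfolding S_def .
qed

text \<open>
  For a unit vector \<open>w\<close> and \<open>K > 0\<close>, this is the complement of the two open balls of radius \<open>1 / (2 K)\<close>
  that touch each other at the origin and have their centres on the line spanned by \<open>w\<close>.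
\<close>
definition thin :: "'a::real_inner \<Rightarrow> real \<Rightarrow> 'a set"
  where "thin w K = {h. \<bar>w \<bullet> h\<bar> \<le> K * (norm h)\<^sup>2}"

lemma thin_measurable [measurable]: "thin (w::'a::euclidean_space) K \<in> sets borel"
  unfolding thin_def by measurable

text \<open>
  Inside the ball of radius \<open>\<rho>\<close>, the thin region lies in a slab of half-width \<open>K \<rho>\<^sup>2\<close>. It therefore
  occupies a fraction of order \<open>K \<rho>\<close> of the ball.
\<close>
lemma measure_thin_ball_le:
  fixes w :: "'a::euclidean_space"
  assumes w: "norm w = 1" and K: "K > 0" and \<rho>: "\<rho> > 0"
  shows "measure lborel (thin w K \<inter> ball 0 \<rho>) \<le> 6 * K * 2 ^ DIM('a) * \<rho> * measure lborel (ball (0::'a) \<rho>)"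
proof -
  let ?S = "{h \<in> ball 0 \<rho>. \<bar>w \<bullet> h\<bar> \<le> K * \<rho>\<^sup>2}"
  have fin: "emeasure lborel X < \<infinity>" if "X \<subseteq> ball 0 r" for X :: "'a set" and r :: real
    using emeasure_mono[OF that, of lborel] emeasure_bounded_finite[of "ball 0 r"]
    by (auto intro: le_less_trans)
  have mono: "measure lborel X \<le> measure lborel Y"
    if "X \<subseteq> Y" "X \<in> sets borel" "Y \<in> sets borel" "Y \<subseteq> ball 0 r" for X Y :: "'a set" and r
    using that fin[OF that(4)] by (intro measure_mono_fmeasurable) (auto simp: fmeasurable_def)
  have sub: "thin w K \<inter> ball 0 \<rho> \<subseteq> ?S"
  proof
    fix h assume h: "h \<in> thin w K \<inter> ball 0 \<rho>"
    then have "\<bar>w \<bullet> h\<bar> \<le> K * (norm h)\<^sup>2" "norm h < \<rho>" by (auto simp: thin_def)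
    moreover from this have "K * (norm h)\<^sup>2 \<le> K * \<rho>\<^sup>2"
      using K by (intro mult_left_mono power_mono) auto
    ultimately show "h \<in> ?S" by simp
  qed
  have S: "?S \<in> sets borel" by measurable
  have m0: "measure lborel (ball (0::'a) \<rho>) \<ge> 0" by simp
  show ?thesis
  proof (cases "6 * K * \<rho> \<le> 1")
    case True
    \<comment> \<open>The number of disjoint translates of the slab, at distance \<open>3 K \<rho>\<^sup>2\<close>, that have room in length \<open>\<rho>\<close>.\<close>
    define n where "n = nat \<lfloor>1 / (3 * K * \<rho>)\<rfloor>"
    have q: "1 / (3 * K * \<rho>) \<ge> 2"
      using True K \<rho> by (simp add: pos_le_divide_eq)
    have n_le: "real n \<le> 1 / (3 * K * \<rho>)"
      using q unfolding n_def by linarith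
    have n_ge: "1 / (6 * K * \<rho>) \<le> real n"
    proof -
      have "1 / (3 * K * \<rho>) - 1 \<le> real n" unfolding n_def using q by linarith
      moreover have "1 / (6 * K * \<rho>) = 1 / (3 * K * \<rho>) / 2" by simp
      ultimately show ?thesis using q by linarith
    qed
    have cond: "real n * (3 * (K * \<rho>\<^sup>2)) \<le> \<rho>"
    proof -
      have "real n * (3 * (K * \<rho>\<^sup>2)) \<le> 1 / (3 * K * \<rho>) * (3 * (K * \<rho>\<^sup>2))"
        using n_le K by (intro mult_right_mono) auto
      also have "\<dots> = \<rho>" using K \<rho> by (simp add: power2_eq_square)
      finally show ?thesis .
    qed
    have "of_nat n * emeasure lborel ?S \<le> emeasure lborel (ball (0::'a) (2 * \<rho>))"
      using emeasure_slab_le[OF w _ cond] K \<rho> by simp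
    then have le: "real n * measure lborel ?S \<le> measure lborel (ball (0::'a) (2 * \<rho>))"
    proof -
      have eq: "emeasure lborel ?S = ennreal (measure lborel ?S)"
        "emeasure lborel (ball (0::'a) (2 * \<rho>)) = ennreal (measure lborel (ball (0::'a) (2 * \<rho>)))"
        by (rule emeasure_eq_ennreal_measure, use fin[of ?S \<rho>] in force)
          (rule emeasure_eq_ennreal_measure, use fin[of "ball 0 (2 * \<rho>)" "2 * \<rho>"] in auto)
      have "ennreal (real n * measure lborel ?S) \<le> ennreal (measure lborel (ball (0::'a) (2 * \<rho>)))"
        using \<open>of_nat n * emeasure lborel ?S \<le> _\<close> unfolding eq
        by (simp only: ennreal_of_nat_eq_real_of_nat ennreal_mult[symmetric] of_nat_0_le_iff measure_nonneg)
      then show ?thesis by (subst (asm) ennreal_le_iff) auto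
    qed
    have "measure lborel ?S = 6 * K * \<rho> * (1 / (6 * K * \<rho>) * measure lborel ?S)"
      using K \<rho> by simp
    also have "\<dots> \<le> 6 * K * \<rho> * (real n * measure lborel ?S)"
      using K \<rho> n_ge by (intro mult_left_mono mult_right_mono) auto
    also have "\<dots> \<le> 6 * K * \<rho> * measure lborel (ball (0::'a) (2 * \<rho>))"
      using K \<rho> le by (intro mult_left_mono) auto
    also have "\<dots> = 6 * K * 2 ^ DIM('a) * \<rho> * measure lborel (ball (0::'a) \<rho>)"
      using \<rho> by (simp add: content_ball power_mult_distrib)
    finally show ?thesis
      using mono[OF sub _ S Collect_restrict] by auto
  next
    case False
    have "measure lborel (thin w K \<inter> ball 0 \<rho>) \<le> measure lborel (ball (0::'a) \<rho>)"
      by (rule mono[of _ _ \<rho>]) auto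
    also have "\<dots> \<le> (6 * K * \<rho> * 2 ^ DIM('a)) * measure lborel (ball (0::'a) \<rho>)"
    proof -
      have "1 * 1 \<le> 6 * K * \<rho> * 2 ^ DIM('a)"
        using False K \<rho> by (intro mult_mono) auto
      from mult_right_mono[OF this m0] show ?thesis by simp
    qed
    finally show ?thesis by (simp add: mult_ac)
  qed
qed

lemma nn_integral_norm_ball_ge:
  assumes \<rho>: "\<rho> > 0"
  shows "ennreal (\<rho> / 4 * measure lborel (ball (0::'a::euclidean_space) \<rho>))
    \<le> (\<integral>\<^sup>+h. ennreal (norm h) * indicator (ball 0 \<rho>) h \<partial>(lborel :: 'a measure))"
proof -
  let ?m = "\<lambda>r. measure lborel (ball (0::'a) r)"
  have "(2::real) ^ 1 \<le> 2 ^ DIM('a)"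
    by (rule power_increasing) auto
  then have "(1/2) ^ DIM('a) \<le> (1/2::real)"
    by (simp add: power_one_over divide_simps)
  then have "?m (\<rho> / 2) \<le> ?m \<rho> / 2"
    using \<rho> mult_right_mono[of "(1/2) ^ DIM('a)" "1/2::real" "\<rho> ^ DIM('a) * unit_ball_vol (real DIM('a))"]
    by (simp add: content_ball power_divide mult_ac)
  moreover have "measure lborel (ball (0::'a) \<rho> - ball 0 (\<rho> / 2)) = ?m \<rho> - ?m (\<rho> / 2)"
    using \<rho> emeasure_bounded_finite[of "ball (0::'a) \<rho>"] by (intro measure_Diff) auto
  ultimately have "\<rho> / 4 * ?m \<rho> \<le> \<rho> / 2 * measure lborel (ball (0::'a) \<rho> - ball 0 (\<rho> / 2))"
    using \<rho> by simp
  then have "ennreal (\<rho> / 4 * ?m \<rho>) \<le> ennreal (\<rho> / 2) * emeasure lborel (ball (0::'a) \<rho> - ball 0 (\<rho> / 2))"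
    using \<rho> emeasure_bounded_finite[of "ball (0::'a) \<rho> - ball 0 (\<rho> / 2)"]
    by (subst emeasure_eq_ennreal_measure) (auto simp: ennreal_mult[symmetric] less_top bounded_diff intro!: ennreal_leI)
  also have "\<dots> = (\<integral>\<^sup>+h. ennreal (\<rho> / 2) * indicator (ball 0 \<rho> - ball 0 (\<rho> / 2)) h \<partial>(lborel :: 'a measure))"
    by (subst nn_integral_cmult_indicator) auto
  also have "\<dots> \<le> (\<integral>\<^sup>+h. ennreal (norm h) * indicator (ball 0 \<rho>) h \<partial>(lborel :: 'a measure))"
    by (intro nn_integral_mono) (auto simp: indicator_def intro!: ennreal_leI)
  finally show ?thesis .
qed

text \<open>
  The key estimate near the singularity: on the thin region, the integral of \<open>j\<close> is controlled by the
  first moment of \<open>j\<close>, which is finite near the origin by hypothesis.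
\<close>
lemma nn_integral_thin_le:
  fixes j :: "'a::euclidean_space \<Rightarrow> real" and w :: 'a
  assumes [measurable]: "j \<in> borel_measurable borel"
    and j: "\<And>h. j h \<ge> 0" "radially_nonincreasing j"
    and w: "norm w = 1" and K: "K > 0" and \<delta>: "\<delta> > 0"
  shows "(\<integral>\<^sup>+h. indicator (thin w K \<inter> ball 0 \<delta>) h * ennreal (j h) \<partial>lborel)
    \<le> ennreal (24 * K * 2 ^ DIM('a)) * (\<integral>\<^sup>+h. indicator (ball 0 \<delta>) h * ennreal (norm h * j h) \<partial>lborel)"
proof -
  define C where "C = 24 * K * 2 ^ DIM('a)"
  have C: "C > 0" using K by (simp add: C_def)
  have [measurable]: "ball (0::'a) \<delta> \<in> sets borel"
    by simp
  have meas: "indicator (thin w K \<inter> ball 0 \<delta>) \<in> borel_measurable borel"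
    "(\<lambda>h. ennreal C * ennreal (norm h) * indicator (ball (0::'a) \<delta>) h) \<in> borel_measurable borel"
    by measurable
  have "(\<integral>\<^sup>+h. indicator (thin w K \<inter> ball 0 \<delta>) h * ennreal (j h) \<partial>lborel) \<le>
    (\<integral>\<^sup>+h. (ennreal C * ennreal (norm h) * indicator (ball 0 \<delta>) h) * ennreal (j h) \<partial>lborel)"
  proof (rule nn_integral_radial_mono[where \<delta>=\<delta>])
    fix r :: real assume r: "r > 0"
    define \<rho> where "\<rho> = min r \<delta>"
    have \<rho>: "\<rho> > 0" using r \<delta> by (simp add: \<rho>_def)
    have [measurable]: "ball (0::'a) \<rho> \<in> sets borel"
      by simp
    have ind: "indicator (ball 0 \<delta>) h * indicator (ball 0 r) h = (indicator (ball 0 \<rho>) h :: ennreal)" for h :: 'a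
      by (auto simp: indicator_def \<rho>_def)
    have "(\<integral>\<^sup>+h. indicator (thin w K \<inter> ball 0 \<delta>) h * indicator (ball 0 r) h \<partial>lborel) =
      (\<integral>\<^sup>+h. indicator (thin w K \<inter> ball 0 \<rho>) h \<partial>lborel)"
      by (intro nn_integral_cong) (auto simp: indicator_def \<rho>_def)
    also have "\<dots> = ennreal (measure lborel (thin w K \<inter> ball 0 \<rho>))"
      using emeasure_bounded_finite[of "thin w K \<inter> ball 0 \<rho>"]
      by (simp add: emeasure_eq_ennreal_measure less_top bounded_Int)
    also have "\<dots> \<le> ennreal C * ennreal (\<rho> / 4 * measure lborel (ball (0::'a) \<rho>))"
      using measure_thin_ball_le[OF w K \<rho>] C \<rho>
      by (subst ennreal_mult[symmetric]) (auto simp: C_def mult_ac intro!: ennreal_leI)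
    also have "\<dots> \<le> ennreal C * (\<integral>\<^sup>+h. ennreal (norm h) * indicator (ball 0 \<rho>) h \<partial>(lborel :: 'a measure))"
      by (intro mult_left_mono nn_integral_norm_ball_ge[OF \<rho>]) simp
    also have "\<dots> = (\<integral>\<^sup>+h. ennreal C * (ennreal (norm h) * indicator (ball 0 \<rho>) h) \<partial>(lborel :: 'a measure))"
      by (rule nn_integral_cmult[symmetric]) measurable
    also have "\<dots> = (\<integral>\<^sup>+h. ennreal C * ennreal (norm h) * indicator (ball 0 \<delta>) h * indicator (ball 0 r) h \<partial>(lborel :: 'a measure))"
      by (intro nn_integral_cong) (simp add: ind[symmetric] mult.assoc)
    finally show "(\<integral>\<^sup>+h. indicator (thin w K \<inter> ball 0 \<delta>) h * indicator (ball 0 r) h \<partial>lborel) \<le> \<dots>" .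
  qed (use j \<delta> meas in auto)
  also have "\<dots> = ennreal C * (\<integral>\<^sup>+h. indicator (ball 0 \<delta>) h * ennreal (norm h * j h) \<partial>lborel)"
    using j by (subst nn_integral_cmult[symmetric]) (auto simp: ennreal_mult mult_ac)
  finally show ?thesis unfolding C_def .
qed


section \<open>Symmetrisation and pinched boundaries\<close>

text \<open>
  The even part of the function \<open>h \<mapsto> chi_tilde E (x + h)\<close>. For an even kernel, replacing the function by
  its even part changes no truncated integral.
\<close>
definition sym_chi :: "'a::real_vector set \<Rightarrow> 'a \<Rightarrow> 'a \<Rightarrow> real"
  where "sym_chi E x h = (chi_tilde E (x + h) + chi_tilde E (x - h)) / 2"

text \<open>
  The ball conditions at \<open>x\<close>, localised to distance less than \<open>\<rho>\<close>: there \<open>E\<close> contains the open ball of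
  radius \<open>1 / (2 K)\<close> with centre \<open>x - w / (2 K)\<close>, and it is disjoint from the one with centre
  \<open>x + w / (2 K)\<close>. In terms of the quadratic inequalities, the property is easily transported by a
  diffeomorphism, with explicit constants.
\<close>
definition pinched :: "'a::real_inner set \<Rightarrow> 'a \<Rightarrow> real \<Rightarrow> real \<Rightarrow> bool"
  where "pinched E x K \<rho> \<longleftrightarrow> (\<exists>w. norm w = 1 \<and> (\<forall>h. norm h < \<rho> \<longrightarrow>
    (w \<bullet> h < - K * (norm h)\<^sup>2 \<longrightarrow> x + h \<in> E) \<and> (w \<bullet> h > K * (norm h)\<^sup>2 \<longrightarrow> x + h \<notin> E)))"

lemma chi_tilde_eq: "chi_tilde E y = 1 - 2 * indicator E y"
  by (simp add: chi_tilde_def indicator_def)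

lemma abs_chi_tilde: "\<bar>chi_tilde E y\<bar> = 1"
  by (simp add: chi_tilde_eq indicator_def)

lemma abs_sym_chi_le: "\<bar>sym_chi E x h\<bar> \<le> 1"
  by (simp add: sym_chi_def chi_tilde_eq indicator_def)

lemma chi_tilde_measurable [measurable]:
  assumes [measurable]: "E \<in> sets borel"
  shows "chi_tilde E \<in> borel_measurable borel"
  unfolding chi_tilde_eq[abs_def] by measurable

lemma sym_chi_measurable [measurable]:
  fixes E :: "'a::euclidean_space set"
  assumes [measurable]: "E \<in> sets borel"
  shows "sym_chi E x \<in> borel_measurable borel"
  unfolding sym_chi_def[abs_def] by measurable

text \<open>
  Off the thin region and close to the origin, exactly one of the points \<open>x + h\<close> and \<open>x - h\<close> belongs to \<open>E\<close>.
\<close>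
lemma sym_chi_eq_0:
  assumes "norm h < \<rho>" "h \<notin> thin w K"
    and "\<And>h. norm h < \<rho> \<Longrightarrow> w \<bullet> h < - K * (norm h)\<^sup>2 \<Longrightarrow> x + h \<in> E"
    and "\<And>h. norm h < \<rho> \<Longrightarrow> w \<bullet> h > K * (norm h)\<^sup>2 \<Longrightarrow> x + h \<notin> E"
  shows "sym_chi E x h = 0"
proof -
  consider "w \<bullet> h < - K * (norm h)\<^sup>2" | "w \<bullet> h > K * (norm h)\<^sup>2"
    using assms(2) by (force simp: thin_def)
  then show ?thesis
  proof cases
    case 1
    then show ?thesis using assms(1) assms(3)[of h] assms(4)[of "- h"]
      by (simp add: sym_chi_def chi_tilde_eq)
  next
    case 2
    then show ?thesis using assms(1) assms(4)[of h] assms(3)[of "- h"]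
      by (simp add: sym_chi_def chi_tilde_eq)
  qed
qed

lemma lborel_distr_uminus_euclidean:
  "distr lborel borel uminus = (lborel :: 'a::euclidean_space measure)"
  using lborel_affine[of "-1" "0::'a"] by (simp add: density_1)

lemma lborel_integral_translate:
  fixes f :: "'a::euclidean_space \<Rightarrow> real"
  assumes "f \<in> borel_measurable borel"
  shows "(LINT y|lborel. f y) = (LINT h|lborel. f (x + h))"
    and "integrable lborel f \<longleftrightarrow> integrable lborel (\<lambda>h. f (x + h))"
  using integral_distr[of "(+) x" lborel borel f] integrable_distr_eq[of "(+) x" lborel borel f] assms
  by (simp_all add: lborel_distr_plus)

lemma lborel_integral_reflect:
  fixes f :: "'a::euclidean_space \<Rightarrow> real"
  assumes "f \<in> borel_measurable borel"
  shows "(LINT y|lborel. f y) = (LINT h|lborel. f (- h))"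
    and "integrable lborel f \<longleftrightarrow> integrable lborel (\<lambda>h. f (- h))"
  using integral_distr[of uminus lborel borel f] integrable_distr_eq[of uminus lborel borel f] assms
  by (simp_all add: lborel_distr_uminus_euclidean)


section \<open>The curvature as an absolutely convergent integral\<close>

text \<open>
  An even kernel \<open>\<phi>\<close> dominated by a radially non-increasing \<open>j\<close> with finite truncated first moment.
  Monotonicity in the norm off the origin already makes \<open>j\<close> radial there.
\<close>
locale curvature_kernel =
  fixes \<phi> j :: "'a::euclidean_space \<Rightarrow> real"
  assumes phi_measurable [measurable]: "\<phi> \<in> borel_measurable borel"
    and phi_nonneg: "\<And>x. \<phi> x \<ge> 0"
    and phi_even: "\<And>x. \<phi> x = \<phi> (- x)"
    and phi_le: "\<And>x. \<phi> x \<le> j x"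
    and j_measurable [measurable]: "j \<in> borel_measurable borel"
    and j_nonneg: "\<And>x. j x \<ge> 0"
    and j_mono: "radially_nonincreasing j"
    and j_integrable: "integrable lborel (\<lambda>x. min 1 (norm x) * j x)"
begin

text \<open>
  The kernel cut off near its singularity; it is integrable.
\<close>
definition far :: "real \<Rightarrow> 'a \<Rightarrow> real"
  where "far r h = indicator (- ball 0 r) h * \<phi> h"

lemma far_measurable [measurable]: "far r \<in> borel_measurable borel"
proof -
  have [measurable]: "ball (0::'a) r \<in> sets borel" by simp
  show ?thesis unfolding far_def by measurable
qed

lemma far_nonneg: "far r h \<ge> 0"
  by (simp add: far_def phi_nonneg)

lemma far_even: "far r (- h) = far r h"
  using phi_even[of h] by (simp add: far_def indicator_def)

lemma far_integrable: "r > 0 \<Longrightarrow> integrable lborel (far r)"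
proof (rule Bochner_Integration.integrable_bound)
  assume r: "r > 0"
  show "integrable lborel (\<lambda>x. 1 / min 1 r * (min 1 (norm x) * j x))"
    using j_integrable by (rule integrable_mult_right)
  show "AE x in lborel. norm (far r x) \<le> norm (1 / min 1 r * (min 1 (norm x) * j x))"
  proof (rule AE_I2)
    fix x
    have "far r x \<le> 1 / min 1 r * (min 1 (norm x) * j x)"
    proof (cases "x \<in> ball 0 r")
      case False
      then have "1 \<le> 1 / min 1 r * min 1 (norm x)"
        using r by (auto simp: pos_le_divide_eq)
      then have "1 * \<phi> x \<le> 1 / min 1 r * min 1 (norm x) * j x"
        using phi_le phi_nonneg by (intro mult_mono) (auto intro: order_trans[of 0 1])
      then show ?thesis using False by (simp add: far_def)
    qed (use r j_nonneg in \<open>auto simp: far_def\<close>)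
    then show "norm (far r x) \<le> norm (1 / min 1 r * (min 1 (norm x) * j x))"
      using abs_of_nonneg[OF far_nonneg[of r x]] order_trans[OF _ abs_ge_self]
      by (metis real_norm_def)
  qed
qed simp

lemma far_chi_integrable:
  assumes "r > 0" and [measurable]: "E \<in> sets borel"
  shows "integrable lborel (\<lambda>h. far r h * chi_tilde E (x + h))"
    and "integrable lborel (\<lambda>h. far r h * chi_tilde E (x - h))"
  by (rule Bochner_Integration.integrable_bound[OF far_integrable[OF assms(1)]];
      simp add: abs_mult abs_chi_tilde)+

lemma truncated_curvature_eq:
  assumes E [measurable]: "E \<in> sets borel" and r: "r > 0"
  shows "set_integrable lborel (- ball x r) (\<lambda>y. chi_tilde E y * \<phi> (x - y))"
    and "truncated_curvature \<phi> x E r = (LINT h|lborel. far r h * chi_tilde E (x + h))"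
proof -
  have [measurable]: "ball x r \<in> sets borel" by simp
  let ?f = "\<lambda>y. indicator (- ball x r) y *\<^sub>R (chi_tilde E y * \<phi> (x - y))"
  have m: "?f \<in> borel_measurable borel"
    by measurable
  have eq: "?f (x + h) = far r h * chi_tilde E (x + h)" for h
    using phi_even[of h] by (simp add: far_def indicator_def dist_norm)
  show "set_integrable lborel (- ball x r) (\<lambda>y. chi_tilde E y * \<phi> (x - y))"
    unfolding set_integrable_def lborel_integral_translate(2)[OF m, of x] eq
    by (rule far_chi_integrable[OF r E])
  show "truncated_curvature \<phi> x E r = (LINT h|lborel. far r h * chi_tilde E (x + h))"
    unfolding truncated_curvature_def set_lebesgue_integral_def lborel_integral_translate(1)[OF m, of x] eq ..
qed

lemma truncated_curvature_sym:
  assumes E [measurable]: "E \<in> sets borel" and r: "r > 0"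
  shows "integrable lborel (\<lambda>h. far r h * sym_chi E x h)"
    and "truncated_curvature \<phi> x E r = (LINT h|lborel. far r h * sym_chi E x h)"
proof -
  note i = far_chi_integrable[OF r E]
  have eq: "far r h * sym_chi E x h = (far r h * chi_tilde E (x + h) + far r h * chi_tilde E (x - h)) / 2" for h
    by (simp add: sym_chi_def distrib_left)
  show "integrable lborel (\<lambda>h. far r h * sym_chi E x h)"
    unfolding eq using i by simp
  have "(LINT h|lborel. far r h * chi_tilde E (x + h)) = (LINT h|lborel. far r h * chi_tilde E (x - h))"
    by (subst lborel_integral_reflect) (simp_all add: far_even)
  then have "(LINT h|lborel. far r h * sym_chi E x h) = (LINT h|lborel. far r h * chi_tilde E (x + h))"
    unfolding eq using i by simp
  then show "truncated_curvature \<phi> x E r = (LINT h|lborel. far r h * sym_chi E x h)"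
    using truncated_curvature_eq(2)[OF E r] by simp
qed

text \<open>
  The first moment of \<open>j\<close> near the origin.
\<close>
definition near_moment :: "real \<Rightarrow> real"
  where "near_moment \<delta> = (LINT h|lborel. indicator (ball 0 \<delta>) h * (norm h * j h))"

lemma near_moment_integrable: "integrable lborel (\<lambda>h. indicator (ball 0 \<delta>) h * (norm h * j h))"
proof (rule Bochner_Integration.integrable_bound)
  have [measurable]: "ball (0::'a) \<delta> \<in> sets borel" by simp
  show "(\<lambda>h. indicator (ball 0 \<delta>) h * (norm h * j h)) \<in> borel_measurable lborel"
    by measurable
  show "integrable lborel (\<lambda>x. max 1 \<delta> * (min 1 (norm x) * j x))"
    using j_integrable by (rule integrable_mult_right)
  show "AE x in lborel. norm (indicator (ball 0 \<delta>) x * (norm x * j x)) \<le> norm (max 1 \<delta> * (min 1 (norm x) * j x))"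
  proof (rule AE_I2)
    fix x :: 'a
    have "norm x * j x \<le> max 1 \<delta> * (min 1 (norm x) * j x)" if "norm x < \<delta>"
    proof -
      have "norm x \<le> max 1 \<delta> * min 1 (norm x)"
      proof (cases "norm x \<le> 1")
        case True
        then show ?thesis using mult_right_mono[of 1 "max 1 \<delta>" "norm x"] by simp
      next
        case False
        then show ?thesis using that by simp
      qed
      from mult_right_mono[OF this j_nonneg[of x]] show ?thesis by (simp add: mult.assoc)
    qed
    then show "norm (indicator (ball 0 \<delta>) x * (norm x * j x)) \<le> norm (max 1 \<delta> * (min 1 (norm x) * j x))"
      using j_nonneg[of x] by (auto simp: indicator_def abs_mult)
  qed
qed

lemma near_moment_nonneg: "near_moment \<delta> \<ge> 0"
  unfolding near_moment_def by (intro integral_nonneg_AE AE_I2) (simp add: j_nonneg)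

lemma near_moment_mono: "\<delta> \<le> \<delta>' \<Longrightarrow> near_moment \<delta> \<le> near_moment \<delta>'"
  unfolding near_moment_def
  by (intro integral_mono near_moment_integrable) (auto simp: indicator_def j_nonneg)

lemma near_moment_tendsto_0: "(near_moment \<longlongrightarrow> 0) (at_right 0)"
proof -
  have "(\<lambda>n. near_moment (1 / real (Suc n))) \<longlonglongrightarrow> (LINT h|(lborel::'a measure). 0)"
    unfolding near_moment_def
  proof (rule integral_dominated_convergence)
    show "integrable lborel (\<lambda>h. indicator (ball 0 1) h * (norm h * j h))"
      by (rule near_moment_integrable)
    show "AE h in lborel. (\<lambda>n. indicator (ball 0 (1 / real (Suc n))) h * (norm h * j h)) \<longlonglongrightarrow> 0"
    proof (rule AE_I2)
      fix h :: 'a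
      show "(\<lambda>n. indicator (ball 0 (1 / real (Suc n))) h * (norm h * j h)) \<longlonglongrightarrow> 0"
      proof (cases "h = 0")
        case False
        have "(\<lambda>n. 1 / real (Suc n)) \<longlonglongrightarrow> 0"
          using LIMSEQ_inverse_real_of_nat by (simp add: inverse_eq_divide)
        then have "\<forall>\<^sub>F n in sequentially. 1 / real (Suc n) < norm h"
          using False by (intro order_tendstoD(2)) auto
        then have "\<forall>\<^sub>F n in sequentially. indicator (ball 0 (1 / real (Suc n))) h * (norm h * j h) = 0"
          by eventually_elim simp
        then show ?thesis by (rule tendsto_eventually)
      qed simp
    qed
    show "AE h in lborel. norm (indicator (ball 0 (1 / real (Suc n))) h * (norm h * j h))
        \<le> indicator (ball 0 1) h * (norm h * j h)" for n
    proof (rule AE_I2)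
      fix h :: 'a
      have "norm h < 1" if "norm h < 1 / real (Suc n)"
        by (rule less_le_trans[OF that]) simp
      then show "norm (indicator (ball 0 (1 / real (Suc n))) h * (norm h * j h))
        \<le> indicator (ball 0 1) h * (norm h * j h)"
        using j_nonneg[of h] by (auto simp: indicator_def simp del: of_nat_Suc)
    qed
  qed (use near_moment_integrable in \<open>blast intro: borel_measurable_integrable\<close>)+
  then have lim: "(\<lambda>n. near_moment (1 / real (Suc n))) \<longlonglongrightarrow> 0" by simp
  show ?thesis
  proof (rule order_tendstoI)
    fix e :: real assume "e < 0"
    then show "\<forall>\<^sub>F r in at_right 0. e < near_moment r"
      using near_moment_nonneg less_le_trans by (intro always_eventually) blast
  next
    fix e :: real assume "0 < e"
    then obtain n where n: "near_moment (1 / real (Suc n)) < e"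
      using order_tendstoD(2)[OF lim] by (auto simp: eventually_sequentially)
    have "\<forall>\<^sub>F r in at_right 0. r < 1 / real (Suc n)"
      by (rule order_tendstoD(2)[OF tendsto_ident_at]) simp
    then show "\<forall>\<^sub>F r in at_right 0. near_moment r < e"
      by eventually_elim (use n near_moment_mono in \<open>meson le_less_trans less_imp_le\<close>)
  qed
qed

text \<open>
  The constant of \<open>nn_integral_thin_le\<close>.
\<close>
definition near_const :: "real \<Rightarrow> real"
  where "near_const K = 24 * K * 2 ^ DIM('a)"

text \<open>
  For a pinched set, the symmetrised integrand is supported near the origin in the thin region, hence
  absolutely integrable; its integral over a small ball is small, uniformly among all sets that are
  pinched with the same constants.
\<close>
lemma near_part:
  assumes E [measurable]: "E \<in> sets borel" and K: "K > 0" and pin: "pinched E x K \<rho>"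
    and \<delta>: "0 < \<delta>" "\<delta> \<le> \<rho>"
  shows "integrable lborel (\<lambda>h. indicator (ball 0 \<delta>) h * (\<phi> h * sym_chi E x h))"
    and "\<bar>LINT h|lborel. indicator (ball 0 \<delta>) h * (\<phi> h * sym_chi E x h)\<bar> \<le> near_const K * near_moment \<delta>"
proof -
  have [measurable]: "ball (0::'a) \<delta> \<in> sets borel" by simp
  let ?f = "\<lambda>h. indicator (ball 0 \<delta>) h * (\<phi> h * sym_chi E x h)"
  have m: "?f \<in> borel_measurable lborel" by measurable
  obtain w where w: "norm w = 1"
    and w': "\<And>h. norm h < \<rho> \<Longrightarrow> w \<bullet> h < - K * (norm h)\<^sup>2 \<Longrightarrow> x + h \<in> E"
      "\<And>h. norm h < \<rho> \<Longrightarrow> w \<bullet> h > K * (norm h)\<^sup>2 \<Longrightarrow> x + h \<notin> E"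
    using pin unfolding pinched_def by blast
  have bd: "\<bar>?f h\<bar> \<le> indicator (thin w K \<inter> ball 0 \<delta>) h * j h" for h
  proof (cases "h \<in> ball 0 \<delta> \<and> h \<notin> thin w K")
    case True
    then have "sym_chi E x h = 0"
      using \<delta> w' by (intro sym_chi_eq_0[of h \<rho> w K x E]) auto
    then show ?thesis using j_nonneg by simp
  next
    case False
    have "\<phi> h * \<bar>sym_chi E x h\<bar> \<le> j h * 1"
      by (intro mult_mono phi_le abs_sym_chi_le) (auto simp: j_nonneg)
    then show ?thesis
      using False phi_nonneg[of h] by (auto simp: indicator_def abs_mult)
  qed
  have "(\<integral>\<^sup>+h. ennreal (norm (?f h)) \<partial>lborel) \<le> (\<integral>\<^sup>+h. indicator (thin w K \<inter> ball 0 \<delta>) h * ennreal (j h) \<partial>lborel)"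
  proof (rule nn_integral_mono)
    fix h
    show "ennreal (norm (?f h)) \<le> indicator (thin w K \<inter> ball 0 \<delta>) h * ennreal (j h)"
      using ennreal_leI[OF bd[of h]] by (cases "h \<in> thin w K \<inter> ball 0 \<delta>") auto
  qed
  also have "\<dots> \<le> ennreal (near_const K) * (\<integral>\<^sup>+h. indicator (ball 0 \<delta>) h * ennreal (norm h * j h) \<partial>lborel)"
    unfolding near_const_def
    by (rule nn_integral_thin_le[OF j_measurable j_nonneg j_mono w K \<delta>(1)])
  also have "(\<integral>\<^sup>+h. indicator (ball 0 \<delta>) h * ennreal (norm h * j h) \<partial>lborel)
      = (\<integral>\<^sup>+h. ennreal (indicator (ball 0 \<delta>) h * (norm h * j h)) \<partial>lborel)"
    by (intro nn_integral_cong) (auto simp: indicator_def)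
  also have "\<dots> = ennreal (near_moment \<delta>)"
    unfolding near_moment_def
    by (rule nn_integral_eq_integral[OF near_moment_integrable]) (simp add: j_nonneg)
  also have "ennreal (near_const K) * ennreal (near_moment \<delta>) = ennreal (near_const K * near_moment \<delta>)"
    using K near_moment_nonneg by (simp add: ennreal_mult near_const_def)
  finally have le: "(\<integral>\<^sup>+h. ennreal (norm (?f h)) \<partial>lborel) \<le> ennreal (near_const K * near_moment \<delta>)" .
  show int: "integrable lborel ?f"
    by (rule integrableI_bounded[OF m]) (use le in \<open>auto intro: le_less_trans\<close>)
  have "\<bar>LINT h|lborel. ?f h\<bar> \<le> (LINT h|lborel. norm (?f h))"
    using integral_norm_bound[of lborel ?f] by simp
  also have "\<dots> \<le> near_const K * near_moment \<delta>"
  proof -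
    have "ennreal (LINT h|lborel. norm (?f h)) = (\<integral>\<^sup>+h. ennreal (norm (?f h)) \<partial>lborel)"
      by (rule nn_integral_eq_integral[symmetric]) (use int in auto)
    then have "ennreal (LINT h|lborel. norm (?f h)) \<le> ennreal (near_const K * near_moment \<delta>)"
      using le by simp
    then show ?thesis
      by (subst (asm) ennreal_le_iff) (use K near_moment_nonneg in \<open>auto simp: near_const_def\<close>)
  qed
  finally show "\<bar>LINT h|lborel. ?f h\<bar> \<le> near_const K * near_moment \<delta>" .
qed

text \<open>
  The nonlocal curvature without its constant, as an absolutely convergent integral instead of a
  principal value.
\<close>
definition curvature_integral :: "'a \<Rightarrow> 'a set \<Rightarrow> real"
  where "curvature_integral x E = (LINT h|lborel. \<phi> h * sym_chi E x h)"

lemma curvature_integral_approx: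
  assumes E: "E \<in> sets borel" and K: "K > 0" and pin: "pinched E x K \<rho>"
    and \<delta>: "0 < \<delta>" "\<delta> \<le> \<rho>"
  shows "\<bar>truncated_curvature \<phi> x E \<delta> - curvature_integral x E\<bar> \<le> near_const K * near_moment \<delta>"
proof -
  have eq: "\<phi> h * sym_chi E x h = indicator (ball 0 \<delta>) h * (\<phi> h * sym_chi E x h) + far \<delta> h * sym_chi E x h" for h
    by (simp add: far_def indicator_def)
  have "curvature_integral x E =
    (LINT h|lborel. indicator (ball 0 \<delta>) h * (\<phi> h * sym_chi E x h)) + truncated_curvature \<phi> x E \<delta>"
    unfolding curvature_integral_def truncated_curvature_sym(2)[OF E \<delta>(1)]
    by (subst eq) (intro Bochner_Integration.integral_add near_part(1)[OF E K pin \<delta>] truncated_curvature_sym(1)[OF E \<delta>(1)])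
  then show ?thesis
    using near_part(2)[OF E K pin \<delta>] by simp
qed

lemma truncated_curvature_tendsto:
  assumes E: "E \<in> sets borel" and K: "K > 0" and pin: "pinched E x K \<rho>" and \<rho>: "\<rho> > 0"
  shows "(truncated_curvature \<phi> x E \<longlongrightarrow> curvature_integral x E) (at_right 0)"
proof -
  have "((\<lambda>r. truncated_curvature \<phi> x E r - curvature_integral x E) \<longlongrightarrow> 0) (at_right 0)"
  proof (rule Lim_null_comparison)
    have "\<forall>\<^sub>F r in at_right 0. r < \<rho>"
      by (rule order_tendstoD(2)[OF tendsto_ident_at]) (use \<rho> in simp)
    moreover have "\<forall>\<^sub>F r in at_right (0::real). 0 < r"
      by (simp add: eventually_at_right_less)
    ultimately show "\<forall>\<^sub>F r in at_right 0.
      norm (truncated_curvature \<phi> x E r - curvature_integral x E) \<le> near_const K * near_moment r"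
      by eventually_elim (use curvature_integral_approx[OF E K pin] in simp)
    show "((\<lambda>r. near_const K * near_moment r) \<longlongrightarrow> 0) (at_right 0)"
      using tendsto_mult_right_zero[OF near_moment_tendsto_0] .
  qed
  then show ?thesis by (simp add: LIM_zero_iff)
qed

lemma nonlocal_curvature_eq:
  assumes E: "E \<in> sets borel" and K: "K > 0" and pin: "pinched E x K \<rho>" and \<rho>: "\<rho> > 0"
  shows "nonlocal_curvature_exists \<phi> x E"
    and "nonlocal_curvature \<phi> x E = 1 / kappa TYPE('a) * curvature_integral x E"
  using truncated_curvature_tendsto[OF assms] truncated_curvature_eq(1)[OF E]
  unfolding nonlocal_curvature_exists_def nonlocal_curvature_def
  by (blast, simp add: tendsto_Lim[OF trivial_limit_at_right_real])

lemma truncated_curvature_set_integral: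
  assumes E [measurable]: "E \<in> sets borel" and r: "r > 0"
  shows "truncated_curvature \<phi> x E r = (LINT h|lborel. far r h) - 2 * (LINT h:{h. x + h \<in> E}|lborel. far r h)"
proof -
  have m: "{h. x + h \<in> E} \<in> sets borel"
  proof -
    have "(+) x -` E \<inter> space borel \<in> sets borel"
      by (rule measurable_sets[OF _ E]) measurable
    then show ?thesis by (simp add: vimage_def)
  qed
  have "truncated_curvature \<phi> x E r = (LINT h|lborel. far r h - 2 * (indicator {h. x + h \<in> E} h * far r h))"
    unfolding truncated_curvature_eq(2)[OF E r]
    by (intro Bochner_Integration.integral_cong) (auto simp: chi_tilde_eq indicator_def)
  also have "\<dots> = (LINT h|lborel. far r h) - 2 * (LINT h:{h. x + h \<in> E}|lborel. far r h)"
    using integrable_imp_set_integrable[OF far_integrable[OF r] m] far_integrable[OF r]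
    by (simp add: set_integrable_def set_lebesgue_integral_def)
  finally show ?thesis .
qed

text \<open>
  The parts near \<open>x\<close> and \<open>p\<close> are small because both sets are pinched with the same constants. The
  remaining parts are integrals of the cut-off kernel over \<open>E - x\<close> and over its image under the near
  isometry \<open>\<Psi>\<close>, where \<open>\<Psi> h = \<Phi> (x + h) - p\<close>. No relation between \<open>p\<close> and \<open>\<Phi> x\<close> is assumed beyond the
  closeness of \<open>p\<close> to \<open>x\<close>.
\<close>
lemma curvature_integral_stable:
  assumes K: "K > 0" and \<rho>: "\<rho> > 0" and \<eta>: "\<eta> > 0"
  shows "\<exists>\<epsilon>>0. \<forall>E x \<Phi> p. E \<in> sets borel \<and> near_isometry \<epsilon> \<Phi> \<and> dist p x \<le> \<epsilon> \<and>
    pinched E x K \<rho> \<and> pinched (\<Phi> ` E) p K \<rho> \<longrightarrow>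
    \<bar>curvature_integral x E - curvature_integral p (\<Phi> ` E)\<bar> \<le> \<eta>"
proof -
  have "((\<lambda>r. near_const K * near_moment r) \<longlongrightarrow> 0) (at_right 0)"
    using tendsto_mult_right_zero[OF near_moment_tendsto_0] .
  then have "\<forall>\<^sub>F r in at_right 0. near_const K * near_moment r < \<eta> / 4"
    using \<eta> by (intro order_tendstoD(2)) auto
  moreover have "\<forall>\<^sub>F r in at_right 0. r < \<rho>"
    by (rule order_tendstoD(2)[OF tendsto_ident_at]) (use \<rho> in simp)
  moreover have "\<forall>\<^sub>F r in at_right (0::real). 0 < r"
    by (simp add: eventually_at_right_less)
  ultimately have "\<forall>\<^sub>F r in at_right 0. near_const K * near_moment r < \<eta> / 4 \<and> r < \<rho> \<and> 0 < r"
    by eventually_elim auto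
  then obtain \<delta> where \<delta>: "near_const K * near_moment \<delta> < \<eta> / 4" "\<delta> \<le> \<rho>" "0 < \<delta>"
    using eventually_happens'[OF trivial_limit_at_right_real] less_imp_le by blast
  obtain \<epsilon> where \<epsilon>: "\<epsilon> > 0" and stab: "\<And>B \<Psi>. B \<in> sets borel \<Longrightarrow> near_isometry \<epsilon> \<Psi> \<Longrightarrow>
    \<bar>(LINT h:B|lborel. far \<delta> h) - (LINT h:\<Psi> ` B|lborel. far \<delta> h)\<bar> \<le> \<eta> / 4"
    using set_integral_near_isometry[OF far_integrable[OF \<delta>(3)], of "\<eta> / 4"] \<eta> by auto
  show ?thesis
  proof (intro exI[of _ "\<epsilon> / 2"] conjI allI impI, goal_cases)
    case (2 E x \<Phi> p)
    then have E: "E \<in> sets borel" and \<Phi>: "near_isometry (\<epsilon> / 2) \<Phi>" and p: "dist p x \<le> \<epsilon> / 2"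
      and pin: "pinched E x K \<rho>" "pinched (\<Phi> ` E) p K \<rho>"
      by auto
    define F where "F = \<Phi> ` E"
    have F: "F \<in> sets borel"
      unfolding F_def using near_isometry_borel_image[OF \<Phi> E] .
    define \<Psi> where "\<Psi> = (\<lambda>h. \<Phi> (x + h) - p)"
    define B where "B = {h. x + h \<in> E}"
    have B: "B \<in> sets borel"
    proof -
      have "(+) x -` E \<inter> space borel \<in> sets borel"
        by (rule measurable_sets[OF _ E]) measurable
      then show ?thesis by (simp add: B_def vimage_def)
    qed
    have bij: "bij \<Phi>" using \<Phi> by (simp add: near_isometry_def)
    have bij\<Psi>: "bij \<Psi>"
    proof -
      have "\<Psi> = (\<lambda>k. k + - p) \<circ> \<Phi> \<circ> (\<lambda>h. h + x)"
        by (auto simp: \<Psi>_def add.commute)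
      moreover have "bij (\<lambda>k::'a. k + - p)" "bij (\<lambda>h::'a. h + x)"
        using bij_plus_right by blast+
      ultimately show ?thesis using bij by (simp add: bij_comp)
    qed
    have "near_isometry \<epsilon> \<Psi>"
    proof -
      have \<Phi>': "near_isometry \<epsilon> \<Phi>"
        using near_isometry_mono[OF \<Phi>] \<epsilon> by simp
      have d: "dist (\<Psi> a) (\<Psi> b) = dist (\<Phi> (x + a)) (\<Phi> (x + b))" "dist a b = dist (x + a) (x + b)" for a b
        by (simp_all add: \<Psi>_def dist_norm)
      have "dist (\<Psi> a) a \<le> \<epsilon>" for a
      proof -
        have "\<Psi> a - a = (\<Phi> (x + a) - (x + a)) + (x - p)"
          by (simp add: \<Psi>_def)
        then have "norm (\<Psi> a - a) \<le> norm (\<Phi> (x + a) - (x + a)) + norm (x - p)"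
          using norm_triangle_ineq by metis
        also have "\<dots> \<le> \<epsilon> / 2 + \<epsilon> / 2"
          using \<Phi> p unfolding near_isometry_def by (intro add_mono) (auto simp: dist_norm norm_minus_commute)
        finally show ?thesis by (simp add: dist_norm)
      qed
      moreover have "dist (\<Psi> a) (\<Psi> b) \<le> (1 + \<epsilon>) * dist a b" "dist a b \<le> (1 + \<epsilon>) * dist (\<Psi> a) (\<Psi> b)" for a b
        unfolding d(1) d(2)[of a b] using \<Phi>' unfolding near_isometry_def by blast+
      ultimately show ?thesis
        using bij\<Psi> unfolding near_isometry_def by blast
    qed
    note st = stab[OF B this]
    have img: "\<Psi> ` B = {k. p + k \<in> F}"
    proof
      show "\<Psi> ` B \<subseteq> {k. p + k \<in> F}"
        by (auto simp: \<Psi>_def B_def F_def)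
      show "{k. p + k \<in> F} \<subseteq> \<Psi> ` B"
      proof
        fix k assume "k \<in> {k. p + k \<in> F}"
        then obtain e where "e \<in> E" "p + k = \<Phi> e" by (auto simp: F_def)
        then have "k = \<Psi> (e - x)" "e - x \<in> B"
          by (auto simp: \<Psi>_def B_def algebra_simps)
        then show "k \<in> \<Psi> ` B" by blast
      qed
    qed
    have "\<bar>truncated_curvature \<phi> x E \<delta> - truncated_curvature \<phi> p F \<delta>\<bar> \<le> \<eta> / 2"
      using st unfolding truncated_curvature_set_integral[OF E \<delta>(3)] truncated_curvature_set_integral[OF F \<delta>(3)]
        img[symmetric] B_def[symmetric] by linarith
    moreover note curvature_integral_approx[OF E K pin(1) \<delta>(3,2)]
      curvature_integral_approx[OF F K _ \<delta>(3,2), of p] pin(2)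
    ultimately show ?case
      using \<delta>(1) unfolding F_def by linarith
  qed (use \<epsilon> in auto)
qed

end


section \<open>Pinching for sets and diffeomorphisms of class C2\<close>

lemma has_derivative_deriv_blinfun:
  assumes "f differentiable (at x)"
  shows "(f has_derivative blinfun_apply (deriv_blinfun f x)) (at x)"
  using assms frechet_derivative_works has_derivative_bounded_linear
  by (metis bounded_linear_Blinfun_apply deriv_blinfun_def)

lemma deriv_blinfun_eqI:
  assumes "(f has_derivative blinfun_apply D) (at x)"
  shows "deriv_blinfun f x = D"
  by (simp add: deriv_blinfun_def blinfun_apply_inverse flip: frechet_derivative_at[OF assms])

lemma C2_normD:
  assumes "C2_norm f \<le> ennreal \<epsilon>" "\<epsilon> \<ge> 0"
  shows "norm (f x) \<le> \<epsilon>" "norm (deriv_blinfun f x) \<le> \<epsilon>" "norm (deriv_blinfun (deriv_blinfun f) x) \<le> \<epsilon>"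
proof -
  let ?A = "SUP x. ennreal (norm (f x))" and ?B = "SUP x. ennreal (norm (deriv_blinfun f x))"
    and ?C = "SUP x. ennreal (norm (deriv_blinfun (deriv_blinfun f) x))"
  have le: "?A + ?B + ?C \<le> ennreal \<epsilon>"
    using assms(1) unfolding C2_norm_def .
  have "?A \<le> ?A + ?B + ?C" "?B \<le> ?A + ?B + ?C" "?C \<le> ?A + ?B + ?C"
    by (auto simp: add.assoc add_increasing add_increasing2)
  then have le': "?A \<le> ennreal \<epsilon>" "?B \<le> ennreal \<epsilon>" "?C \<le> ennreal \<epsilon>"
    using le order_trans by blast+
  have "ennreal (norm (f x)) \<le> ?A" "ennreal (norm (deriv_blinfun f x)) \<le> ?B"
    "ennreal (norm (deriv_blinfun (deriv_blinfun f) x)) \<le> ?C"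
    by (rule SUP_upper; simp)+
  then have "ennreal (norm (f x)) \<le> ennreal \<epsilon>" "ennreal (norm (deriv_blinfun f x)) \<le> ennreal \<epsilon>"
    "ennreal (norm (deriv_blinfun (deriv_blinfun f) x)) \<le> ennreal \<epsilon>"
    using le' order_trans by blast+
  then show "norm (f x) \<le> \<epsilon>" "norm (deriv_blinfun f x) \<le> \<epsilon>" "norm (deriv_blinfun (deriv_blinfun f) x) \<le> \<epsilon>"
    using assms(2) by (simp_all add: ennreal_le_iff)
qed

lemma C2_on_minus_id:
  fixes f :: "'a::real_normed_vector \<Rightarrow> 'a"
  assumes "C2_on f UNIV"
  shows "C2_on (\<lambda>y. f y - y) UNIV"
proof -
  have d1: "f differentiable (at x)" and d2: "deriv_blinfun f differentiable (at x)" for x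
    using assms by (auto simp: C2_on_def)
  have 1: "((\<lambda>y. f y - y) has_derivative blinfun_apply (deriv_blinfun f x - id_blinfun)) (at x)" for x
    by (rule has_derivative_eq_rhs, rule has_derivative_diff[OF has_derivative_deriv_blinfun[OF d1] has_derivative_ident])
      (simp add: blinfun.diff_left fun_eq_iff)
  have e1: "deriv_blinfun (\<lambda>y. f y - y) = (\<lambda>x. deriv_blinfun f x - id_blinfun)"
    using deriv_blinfun_eqI[OF 1] by (rule ext)
  have 2: "((\<lambda>x. deriv_blinfun f x - id_blinfun) has_derivative
      blinfun_apply (deriv_blinfun (deriv_blinfun f) x)) (at x)" for x
    by (rule has_derivative_eq_rhs, rule has_derivative_diff[OF has_derivative_deriv_blinfun[OF d2] has_derivative_const])
      (simp add: fun_eq_iff)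
  have e2: "deriv_blinfun (\<lambda>x. deriv_blinfun f x - id_blinfun) = deriv_blinfun (deriv_blinfun f)"
    using deriv_blinfun_eqI[OF 2] by (rule ext)
  show ?thesis
    unfolding C2_on_def e1 e2
    using 1 2 assms unfolding differentiable_def C2_on_def by blast
qed

lemma deriv_blinfun_lipschitz:
  assumes "convex S" "\<And>y. y \<in> S \<Longrightarrow> f differentiable (at y)"
    "\<And>y. y \<in> S \<Longrightarrow> norm (deriv_blinfun f y) \<le> M" "a \<in> S" "b \<in> S"
  shows "norm (f a - f b) \<le> M * norm (a - b)"
proof (rule differentiable_bound[OF assms(1)])
  show "(f has_derivative blinfun_apply (deriv_blinfun f y)) (at y within S)" if "y \<in> S" for y
    by (rule has_derivative_at_withinI[OF has_derivative_deriv_blinfun[OF assms(2)[OF that]]])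
  show "onorm (blinfun_apply (deriv_blinfun f y)) \<le> M" if "y \<in> S" for y
    using assms(3)[OF that] by (simp add: norm_blinfun.rep_eq)
qed (use assms in auto)

lemma taylor_quadratic_bound:
  fixes f :: "'a::real_normed_vector \<Rightarrow> 'b::real_normed_vector"
  assumes S: "convex S" "x \<in> S" "x + h \<in> S" and M: "M \<ge> 0"
    and d1: "\<And>y. y \<in> S \<Longrightarrow> f differentiable (at y)"
    and d2: "\<And>y. y \<in> S \<Longrightarrow> deriv_blinfun f differentiable (at y)"
    and bd: "\<And>y. y \<in> S \<Longrightarrow> norm (deriv_blinfun (deriv_blinfun f) y) \<le> M"
  shows "norm (f (x + h) - f x - deriv_blinfun f x h) \<le> M * (norm h)\<^sup>2"
proof -
  let ?T = "S \<inter> cball x (norm h)"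
  have "norm (f (x + h) - f x - blinfun_apply (deriv_blinfun f x) (x + h - x)) \<le> norm (x + h - x) * (M * norm h)"
  proof (rule differentiable_bound_linearization[where S="?T"])
    fix t :: real assume t: "t \<in> {0..1}"
    have "convex ?T" using S by (intro convex_Int) auto
    moreover have "x + t *\<^sub>R (x + h - x) = (1 - t) *\<^sub>R x + t *\<^sub>R (x + h)"
      by (simp add: algebra_simps)
    ultimately show "x + t *\<^sub>R (x + h - x) \<in> ?T"
      using S t unfolding convex_alt by (auto simp: dist_norm)
  next
    fix y assume y: "y \<in> ?T"
    show "(f has_derivative blinfun_apply (deriv_blinfun f y)) (at y within ?T)"
      using y by (intro has_derivative_at_withinI[OF has_derivative_deriv_blinfun] d1) auto
    have "norm (deriv_blinfun f y - deriv_blinfun f x) \<le> M * norm (y - x)"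
      by (rule deriv_blinfun_lipschitz[OF S(1) d2 bd]) (use y S in auto)
    also have "\<dots> \<le> M * norm h"
      using y M by (intro mult_left_mono) (auto simp: dist_norm norm_minus_commute)
    finally show "onorm (blinfun_apply (deriv_blinfun f y) - blinfun_apply (deriv_blinfun f x)) \<le> M * norm h"
      by (simp add: norm_blinfun.rep_eq minus_blinfun.rep_eq fun_diff_def)
  qed (use S in auto)
  then show ?thesis by (simp add: power2_eq_square mult_ac)
qed

text \<open>
  A map that differs from the identity by an \<open>\<epsilon>\<close>-Lipschitz map multiplies distances by a factor
  between \<open>1 - \<epsilon>\<close> and \<open>1 + \<epsilon>\<close>, and the inverse of \<open>1 - \<epsilon>\<close> is at most \<open>1 + 2 \<epsilon>\<close> for \<open>\<epsilon> \<le> 1 / 2\<close>.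
\<close>
lemma C2_near_identity:
  fixes \<Phi> :: "'a::euclidean_space \<Rightarrow> 'a"
  assumes \<Phi>: "C2_diffeo \<Phi>" and \<epsilon>: "0 \<le> \<epsilon>" "\<epsilon> \<le> 1 / 2" and n: "C2_norm (\<lambda>y. \<Phi> y - y) \<le> ennreal \<epsilon>"
  shows "near_isometry (2 * \<epsilon>) \<Phi>"
proof -
  define u where "u = (\<lambda>y. \<Phi> y - y)"
  have C2: "C2_on u UNIV"
    using \<Phi> C2_on_minus_id by (auto simp: u_def C2_diffeo_def)
  have lip: "norm (u a - u b) \<le> \<epsilon> * norm (a - b)" for a b
    by (rule deriv_blinfun_lipschitz[of UNIV])
      (use C2 C2_normD(2)[OF n \<epsilon>(1)] in \<open>auto simp: C2_on_def u_def\<close>)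
  have eq: "\<Phi> a - \<Phi> b = (a - b) + (u a - u b)" for a b
    by (simp add: u_def)
  have "dist (\<Phi> a) (\<Phi> b) \<le> (1 + 2 * \<epsilon>) * dist a b" for a b
  proof -
    have "norm (\<Phi> a - \<Phi> b) \<le> norm (a - b) + norm (u a - u b)"
      unfolding eq by (rule norm_triangle_ineq)
    moreover have "\<epsilon> * norm (a - b) \<ge> 0" using \<epsilon> by simp
    ultimately show ?thesis using lip[of a b] by (simp add: dist_norm algebra_simps)
  qed
  moreover have "dist a b \<le> (1 + 2 * \<epsilon>) * dist (\<Phi> a) (\<Phi> b)" for a b
  proof -
    have "norm (a - b) - norm (u a - u b) \<le> norm (\<Phi> a - \<Phi> b)"
      unfolding eq by (rule norm_diff_ineq)
    then have "(1 - \<epsilon>) * norm (a - b) \<le> norm (\<Phi> a - \<Phi> b)"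
      using lip[of a b] by (simp add: algebra_simps)
    then have "(1 + 2 * \<epsilon>) * ((1 - \<epsilon>) * norm (a - b)) \<le> (1 + 2 * \<epsilon>) * norm (\<Phi> a - \<Phi> b)"
      using \<epsilon> by (intro mult_left_mono) auto
    moreover have "1 \<le> (1 + 2 * \<epsilon>) * (1 - \<epsilon>)"
    proof -
      have "\<epsilon> * (2 * \<epsilon>) \<le> \<epsilon> * 1" using \<epsilon> by (intro mult_left_mono) auto
      then show ?thesis by (simp add: algebra_simps)
    qed
    then have "1 * norm (a - b) \<le> (1 + 2 * \<epsilon>) * (1 - \<epsilon>) * norm (a - b)"
      by (rule mult_right_mono) simp
    ultimately show ?thesis by (simp add: dist_norm mult.assoc)
  qed
  moreover have "dist (\<Phi> a) a \<le> 2 * \<epsilon>" for a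
    using C2_normD(1)[OF n \<epsilon>(1), of a] \<epsilon> by (simp add: dist_norm)
  ultimately show ?thesis
    using \<Phi> by (simp add: near_isometry_def C2_diffeo_def)
qed

text \<open>
  It is often convenient to use a normal vector that is not normalised.
\<close>
lemma pinched_normalize:
  fixes w :: "'a::real_inner"
  assumes w: "norm w \<ge> c" "c > 0" and K: "K \<ge> 0"
    and "\<And>h. norm h < \<rho> \<Longrightarrow> w \<bullet> h < - K * (norm h)\<^sup>2 \<Longrightarrow> x + h \<in> E"
    and "\<And>h. norm h < \<rho> \<Longrightarrow> w \<bullet> h > K * (norm h)\<^sup>2 \<Longrightarrow> x + h \<notin> E"
  shows "pinched E x (K / c) \<rho>"
  unfolding pinched_def
proof (intro exI[of _ "w /\<^sub>R norm w"] conjI allI impI)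
  have pos: "norm w > 0" using w by linarith
  then show "norm (w /\<^sub>R norm w) = 1" by simp
  have le: "K * (norm h)\<^sup>2 \<le> norm w * (K / c * (norm h)\<^sup>2)" for h :: 'a
  proof -
    have "K * (norm h)\<^sup>2 = c * (K / c * (norm h)\<^sup>2)" using w by simp
    also have "\<dots> \<le> norm w * (K / c * (norm h)\<^sup>2)"
      using w K by (intro mult_right_mono) auto
    finally show ?thesis .
  qed
  have eq: "w \<bullet> h = norm w * ((w /\<^sub>R norm w) \<bullet> h)" for h
    using pos by simp
  fix h :: 'a assume h: "norm h < \<rho>"
  show "x + h \<in> E" if "(w /\<^sub>R norm w) \<bullet> h < - (K / c) * (norm h)\<^sup>2"
  proof -
    have "w \<bullet> h < norm w * (- (K / c) * (norm h)\<^sup>2)"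
      unfolding eq using that pos by (rule mult_strict_left_mono)
    then show ?thesis using le[of h] assms(4)[OF h] by simp
  qed
  show "x + h \<notin> E" if "(w /\<^sub>R norm w) \<bullet> h > (K / c) * (norm h)\<^sup>2"
  proof -
    have "w \<bullet> h > norm w * ((K / c) * (norm h)\<^sup>2)"
      unfolding eq using that pos by (rule mult_strict_left_mono)
    then show ?thesis using le[of h] assms(5)[OF h] by simp
  qed
qed

lemma pinched_mono:
  assumes "pinched E x K \<rho>" "K \<le> K'" "\<rho>' \<le> \<rho>"
  shows "pinched E x K' \<rho>'"
proof -
  have "K * (norm h)\<^sup>2 \<le> K' * (norm h)\<^sup>2" for h :: 'a
    using assms(2) by (intro mult_right_mono) auto
  then show ?thesis
    using assms(1,3) unfolding pinched_def
    by (smt (verit, ccfv_threshold) mult_minus_left)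
qed

text \<open>
  The vector \<open>w'\<close> is the image of \<open>w\<close> under the inverse of the transpose of \<open>A\<close>: the normal vector of
  the hyperplane orthogonal to \<open>w\<close> after the linear map \<open>A\<close>.
\<close>
lemma adjoint_inverse_covector:
  fixes A :: "'a::euclidean_space \<Rightarrow> 'a"
  assumes A: "linear A" and lo: "\<And>h. norm h \<le> 2 * norm (A h)" and up: "\<And>h. norm (A h) \<le> 3 / 2 * norm h"
    and w: "norm w = 1"
  obtains w' where "\<And>h. w' \<bullet> A h = w \<bullet> h" "norm w' \<ge> 2 / 3" "norm w' \<le> 2"
proof -
  have "inj A"
  proof (rule linear_injective_0[OF A, THEN iffD2], intro allI impI)
    fix v assume "A v = 0"
    then show "v = 0" using lo[of v] by simp
  qed
  then obtain B where B: "linear B" "B \<circ> A = id"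
    using linear_injective_left_inverse[OF A] by blast
  then have AB: "A (B k) = k" for k
    using linear_inverse_left[OF A B(1)] by (simp add: fun_eq_iff)
  define w' where "w' = adjoint B w"
  have w'B: "w' \<bullet> k = B k \<bullet> w" for k
    using adjoint_works[OF B(1), of k w] by (simp add: w'_def inner_commute)
  show thesis
  proof
    show eq: "w' \<bullet> A h = w \<bullet> h" for h
      using w'B[of "A h"] B(2) by (simp add: fun_eq_iff inner_commute)
    have "1 = w' \<bullet> A w"
      using eq[of w] w by (simp add: dot_square_norm)
    also have "\<dots> \<le> norm w' * norm (A w)"
      by (rule norm_cauchy_schwarz)
    also have "\<dots> \<le> norm w' * (3 / 2)"
      using up[of w] w by (intro mult_left_mono) auto
    finally show "norm w' \<ge> 2 / 3" by simp
    have "norm w' * norm w' = w' \<bullet> w'"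
      by (simp add: dot_square_norm power2_eq_square)
    also have "\<dots> \<le> norm (B w') * norm w"
      unfolding w'B by (rule norm_cauchy_schwarz)
    also have "\<dots> \<le> 2 * norm w'"
      using lo[of "B w'"] w by (simp add: AB)
    finally show "norm w' \<le> 2"
      using mult_right_le_imp_le[of "norm w'" "norm w'" 2] by (cases "w' = 0") auto
  qed
qed

text \<open>
  Write \<open>\<Phi> (x + h) = \<Phi> x + k\<close> and let \<open>A\<close> be the derivative of \<open>\<Phi>\<close> at \<open>x\<close>. By Taylor, \<open>k\<close> differs
  from \<open>A h\<close> by at most half of the square of the norm of \<open>h\<close>. With the transported normal vector \<open>w'\<close>
  the linear terms \<open>w' \<bullet> k\<close> and \<open>w \<bullet> h\<close> then agree up to a quadratic error, which is absorbed by
  enlarging \<open>K\<close>.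
\<close>
lemma pinched_C2_image:
  fixes \<Phi> :: "'a::euclidean_space \<Rightarrow> 'a"
  assumes \<Phi>: "C2_diffeo \<Phi>" and n: "C2_norm (\<lambda>y. \<Phi> y - y) \<le> ennreal (1 / 2)"
    and K: "K \<ge> 0" and pin: "pinched E x K \<rho>"
  shows "pinched (\<Phi> ` E) (\<Phi> x) (6 * K + 6) (\<rho> / 2)"
proof -
  define u where "u = (\<lambda>y. \<Phi> y - y)"
  define L where "L = deriv_blinfun u x"
  define A where "A = (\<lambda>h. h + blinfun_apply L h)"
  have C2: "C2_on u UNIV"
    using \<Phi> C2_on_minus_id by (auto simp: u_def C2_diffeo_def)
  have bij: "bij \<Phi>" using \<Phi> by (simp add: C2_diffeo_def)
  have ni: "near_isometry 1 \<Phi>"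
    using C2_near_identity[OF \<Phi> _ _ n] by simp
  have nL: "norm L \<le> 1 / 2"
    using C2_normD(2)[OF n] by (simp add: u_def L_def)
  have Lh: "norm (blinfun_apply L h) \<le> 1 / 2 * norm h" for h
    using norm_blinfun[of L h] mult_right_mono[OF nL norm_ge_zero[of h]] by linarith
  have linA: "linear A"
    unfolding A_def by (intro linear_compose_add linear_ident bounded_linear.linear[OF blinfun.bounded_linear_right])
  have lo: "norm h \<le> 2 * norm (A h)" for h
    using norm_diff_ineq[of h "blinfun_apply L h"] Lh[of h] by (simp add: A_def)
  have up: "norm (A h) \<le> 3 / 2 * norm h" for h
    using norm_triangle_ineq[of h "blinfun_apply L h"] Lh[of h] by (simp add: A_def)
  obtain w where w: "norm w = 1"
    and wE: "\<And>h. norm h < \<rho> \<Longrightarrow> w \<bullet> h < - K * (norm h)\<^sup>2 \<Longrightarrow> x + h \<in> E"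
      "\<And>h. norm h < \<rho> \<Longrightarrow> w \<bullet> h > K * (norm h)\<^sup>2 \<Longrightarrow> x + h \<notin> E"
    using pin unfolding pinched_def by blast
  obtain w' where w': "\<And>h. w' \<bullet> A h = w \<bullet> h" "norm w' \<ge> 2 / 3" "norm w' \<le> 2"
    using adjoint_inverse_covector[OF linA lo up w] by blast
  have key: "\<exists>h. norm h < \<rho> \<and> \<Phi> (x + h) = \<Phi> x + k \<and> \<bar>w' \<bullet> k - w \<bullet> h\<bar> \<le> (norm h)\<^sup>2 \<and> (norm h)\<^sup>2 \<le> 4 * (norm k)\<^sup>2"
    if k: "norm k < \<rho> / 2" for k :: 'a
  proof -
    define h where "h = inv \<Phi> (\<Phi> x + k) - x"
    have eq: "\<Phi> (x + h) = \<Phi> x + k"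
      using bij by (simp add: h_def bij_is_surj surj_f_inv_f)
    have "dist (x + h) x \<le> 2 * dist (\<Phi> (x + h)) (\<Phi> x)"
      using ni unfolding near_isometry_def by (metis one_add_one)
    then have hk: "norm h \<le> 2 * norm k"
      by (simp add: eq dist_norm)
    define e where "e = u (x + h) - u x - blinfun_apply L h"
    have "norm e \<le> 1 / 2 * (norm h)\<^sup>2"
      unfolding e_def L_def
      by (rule taylor_quadratic_bound[where S=UNIV])
        (use C2 C2_normD(3)[OF n] in \<open>auto simp: C2_on_def u_def\<close>)
    moreover have "k = A h + e"
      using eq by (simp add: e_def A_def u_def algebra_simps)
    then have "w' \<bullet> k - w \<bullet> h = w' \<bullet> e"
      using w'(1)[of h] by (simp add: inner_add_right)
    moreover have "\<bar>w' \<bullet> e\<bar> \<le> norm w' * norm e"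
      by (rule Cauchy_Schwarz_ineq2)
    moreover have "norm w' * norm e \<le> 2 * norm e"
      using w'(3) by (intro mult_right_mono) auto
    ultimately have "\<bar>w' \<bullet> k - w \<bullet> h\<bar> \<le> (norm h)\<^sup>2" by linarith
    moreover have "(norm h)\<^sup>2 \<le> (2 * norm k)\<^sup>2"
      using hk by (intro power_mono) auto
    ultimately show ?thesis
      using eq hk k by (intro exI[of _ h]) (auto simp: power_mult_distrib)
  qed
  have mem: "\<Phi> a \<in> \<Phi> ` E \<longleftrightarrow> a \<in> E" for a
    using bij by (simp add: bij_is_inj inj_image_mem_iff)
  have "pinched (\<Phi> ` E) (\<Phi> x) ((4 * K + 4) / (2 / 3)) (\<rho> / 2)"
  proof (rule pinched_normalize[OF w'(2)])
    fix k :: 'a assume k: "norm k < \<rho> / 2"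
    obtain h where h: "norm h < \<rho>" "\<Phi> (x + h) = \<Phi> x + k" "\<bar>w' \<bullet> k - w \<bullet> h\<bar> \<le> (norm h)\<^sup>2"
      "(norm h)\<^sup>2 \<le> 4 * (norm k)\<^sup>2"
      using key[OF k] by blast
    have "(K + 1) * (norm h)\<^sup>2 \<le> (K + 1) * (4 * (norm k)\<^sup>2)"
      using h(4) K by (intro mult_left_mono) auto
    then have le: "(K + 1) * (norm h)\<^sup>2 \<le> (4 * K + 4) * (norm k)\<^sup>2"
      by (simp add: algebra_simps)
    show "\<Phi> x + k \<in> \<Phi> ` E" if "w' \<bullet> k < - (4 * K + 4) * (norm k)\<^sup>2"
    proof -
      have "w \<bullet> h < - K * (norm h)\<^sup>2"
        using that le h(3) by (simp add: algebra_simps abs_le_iff)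
      then show ?thesis using wE(1)[OF h(1)] mem h(2) by metis
    qed
    show "\<Phi> x + k \<notin> \<Phi> ` E" if "w' \<bullet> k > (4 * K + 4) * (norm k)\<^sup>2"
    proof -
      have "w \<bullet> h > K * (norm h)\<^sup>2"
        using that le h(3) by (simp add: algebra_simps abs_le_iff)
      then show ?thesis using wE(2)[OF h(1)] mem h(2) by metis
    qed
  qed (use K in auto)
  moreover have "(4 * K + 4) / (2 / 3) = 6 * K + 6"
    by simp
  ultimately show ?thesis by (simp only:)
qed

text \<open>
  The two balls are disjoint and have the point \<open>x\<close> in both boundaries, so that their centres are
  opposite to each other with respect to \<open>x\<close>.
\<close>
lemma ball_conditions_imp_pinched:
  fixes x :: "'a::euclidean_space"
  assumes R: "R > 0" and "interior_ball_condition R E x" "exterior_ball_condition R E x"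
  shows "pinched E x (1 / (2 * R)) \<rho>"
proof -
  obtain c c' where c: "ball c R \<subseteq> E" "x \<in> frontier (ball c R)" and c': "ball c' R \<subseteq> - E" "x \<in> frontier (ball c' R)"
    using assms(2,3) unfolding interior_ball_condition_def exterior_ball_condition_def by blast
  define a where "a = c - x"
  define b where "b = c' - x"
  have na: "norm a = R" "norm b = R"
    using c(2) c'(2) R by (auto simp: a_def b_def frontier_ball dist_norm norm_minus_commute)
  have "dist c c' \<ge> 2 * R"
  proof (rule ccontr)
    assume "\<not> dist c c' \<ge> 2 * R"
    then have "midpoint c c' \<in> ball c R" "midpoint c c' \<in> ball c' R"
      by (simp_all add: dist_midpoint)
    then show False using c c' by blast
  qed
  then have "norm (a - b) \<ge> 2 * R"
    by (simp add: a_def b_def dist_norm)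
  then have "(norm (a - b))\<^sup>2 \<ge> (2 * R)\<^sup>2"
    using R by (intro power_mono) auto
  moreover have "(norm (a + b))\<^sup>2 + (norm (a - b))\<^sup>2 = 2 * (norm a)\<^sup>2 + 2 * (norm b)\<^sup>2"
    by (simp add: power2_norm_eq_inner inner_add inner_diff inner_commute)
  moreover have "(2 * R)\<^sup>2 = 4 * R\<^sup>2"
    by (simp add: power_mult_distrib)
  \<comment> \<open>The parallelogram law forces the two centres to be opposite.\<close>
  ultimately have "(norm (a + b))\<^sup>2 \<le> 0"
    unfolding na by linarith
  then have ab: "b = - a"
    by (simp add: eq_neg_iff_add_eq_0 add.commute)
  have inb: "x + h \<in> ball c R \<longleftrightarrow> (norm h)\<^sup>2 < 2 * (a \<bullet> h)"
    "x + h \<in> ball c' R \<longleftrightarrow> (norm h)\<^sup>2 < 2 * (- a \<bullet> h)" for h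
  proof -
    have "x + h \<in> ball (x + v) R \<longleftrightarrow> (norm h)\<^sup>2 < 2 * (v \<bullet> h)" if v: "norm v = R" for v
    proof -
      have "x + h \<in> ball (x + v) R \<longleftrightarrow> norm (v - h) < R"
        by (simp add: dist_norm)
      also have "\<dots> \<longleftrightarrow> (norm (v - h))\<^sup>2 < R\<^sup>2"
        using R power_mono_iff[of R "norm (v - h)" 2] by (simp add: not_le[symmetric])
      also have "(norm (v - h))\<^sup>2 = R\<^sup>2 - 2 * (v \<bullet> h) + (norm h)\<^sup>2"
        unfolding v[symmetric] power2_norm_eq_inner by (simp add: inner_diff inner_commute)
      finally show ?thesis by linarith
    qed
    from this[of a] this[of b] show "x + h \<in> ball c R \<longleftrightarrow> (norm h)\<^sup>2 < 2 * (a \<bullet> h)"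
      "x + h \<in> ball c' R \<longleftrightarrow> (norm h)\<^sup>2 < 2 * (- a \<bullet> h)"
      using na ab by (auto simp: a_def b_def)
  qed
  have "pinched E x (1 / 2 / R) \<rho>"
  proof (rule pinched_normalize[of R "- a"])
    fix h :: 'a assume h: "norm h < \<rho>"
    show "x + h \<in> E" if "- a \<bullet> h < - (1 / 2) * (norm h)\<^sup>2"
      using that inb(1)[of h] c(1) by auto
    show "x + h \<notin> E" if "- a \<bullet> h > 1 / 2 * (norm h)\<^sup>2"
      using that inb(2)[of h] c'(1) by auto
  qed (use R na in auto)
  then show ?thesis by simp
qed

lemma C2_sets_closed: "E \<in> C2_sets \<Longrightarrow> closed E"
  by (auto simp: C2_sets_def)

text \<open>
  The constants can be chosen locally uniformly along the boundary: near \<open>x\<close>, the defining function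
  has a bounded second derivative and a gradient bounded away from 0. The normal vector at \<open>y\<close> is the
  gradient at \<open>y\<close>.
\<close>
lemma C2_sets_pinched:
  fixes E :: "'a::euclidean_space set"
  assumes E: "E \<in> C2_sets" and x: "x \<in> frontier E"
  shows "\<exists>K>0. \<exists>\<rho>>0. \<forall>y\<in>frontier E. dist y x < \<rho> \<longrightarrow> pinched E y K \<rho>"
proof -
  obtain U where U: "open U" "E = closure U" "C2_boundary U"
    using E by (auto simp: C2_sets_def)
  have fr: "frontier E \<subseteq> frontier U"
    using interior_mono[OF closure_subset[of U]] by (auto simp: frontier_def U(2))
  obtain N and g :: "'a \<Rightarrow> real" where N: "open N" "x \<in> N" "C2_on g N"
    "\<And>y. y \<in> N \<Longrightarrow> deriv_blinfun g y \<noteq> 0" "U \<inter> N = {y \<in> N. g y < 0}"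
    using U(3)[unfolded C2_boundary_def, rule_format, OF subsetD[OF fr x]] by blast
  define D where "D = deriv_blinfun g"
  have d1: "g differentiable (at y)" and d2: "D differentiable (at y)" if "y \<in> N" for y
    using N(3) that by (auto simp: C2_on_def D_def)
  have contg: "continuous_on N g"
    using d1 by (meson continuous_at_imp_continuous_on differentiable_imp_continuous_within)
  have out: "z \<notin> closure U" if "z \<in> N" "g z > 0" for z
  proof -
    have "open (N \<inter> g -` {0<..})"
      by (rule continuous_open_preimage[OF contg N(1)]) simp
    moreover have "(N \<inter> g -` {0<..}) \<inter> U = {}"
      using N(5) by (auto simp: set_eq_iff) (metis less_asym)
    ultimately have "(N \<inter> g -` {0<..}) \<inter> closure U = {}"
      using open_Int_closure_eq_empty by blast
    then show ?thesis using that by auto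
  qed
  have "isCont D x"
    using d2[OF N(2)] differentiable_imp_continuous_within by blast
  define c where "c = norm (D x) / 2"
  have c: "c > 0" using N(4)[OF N(2)] by (simp add: c_def D_def)
  obtain r1 where r1: "r1 > 0" "\<And>y. dist y x < r1 \<Longrightarrow> dist (D y) (D x) < c"
    using \<open>isCont D x\<close> c unfolding continuous_at_eps_delta by blast
  define M where "M = norm (deriv_blinfun D x) + 1"
  have M: "M > 0" using norm_ge_zero[of "deriv_blinfun D x"] by (simp add: M_def add_nonneg_pos)
  have "isCont (deriv_blinfun D) x"
    using N(1,2,3) continuous_on_eq_continuous_at unfolding C2_on_def D_def by blast
  then obtain r2 where r2: "r2 > 0" "\<And>y. dist y x < r2 \<Longrightarrow> dist (deriv_blinfun D y) (deriv_blinfun D x) < 1"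
    unfolding continuous_at_eps_delta by (meson zero_less_one)
  obtain r3 where r3: "r3 > 0" "ball x r3 \<subseteq> N"
    using N(1,2) open_contains_ball by blast
  define \<rho> where "\<rho> = min r1 (min r2 r3) / 2"
  have \<rho>: "\<rho> > 0" using r1 r2 r3 by (simp add: \<rho>_def)
  define S where "S = ball x (2 * \<rho>)"
  have S: "convex S" "S \<subseteq> N"
    using r3 by (auto simp: S_def \<rho>_def)
  have S1: "dist y x < r1" "dist y x < r2" if "y \<in> S" for y
    using that by (auto simp: S_def \<rho>_def dist_commute)
  have bd: "norm (deriv_blinfun D y) \<le> M" if "y \<in> S" for y
  proof -
    have "norm (deriv_blinfun D y) \<le> norm (deriv_blinfun D x) + norm (deriv_blinfun D y - deriv_blinfun D x)"
      by (metis add.commute diff_add_cancel norm_triangle_ineq)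
    then show ?thesis using r2(2)[OF S1(2)[OF that]] by (simp add: M_def dist_norm)
  qed
  have Dlow: "norm (D y) \<ge> c" if "y \<in> S" for y
  proof -
    have "norm (D x) \<le> norm (D y) + norm (D y - D x)"
      by (metis add.commute diff_add_cancel norm_minus_commute norm_triangle_ineq)
    then show ?thesis using r1(2)[OF S1(1)[OF that]] by (simp add: c_def dist_norm)
  qed
  have "pinched E y (M / c) \<rho>" if y: "y \<in> frontier E" "dist y x < \<rho>" for y
  proof -
    have yS: "y \<in> S" using y \<rho> by (simp add: S_def dist_commute)
    have gy: "g y = 0"
    proof -
      have "y \<in> closure U" "y \<notin> U"
        using y fr U(1) by (auto simp: frontier_def interior_open)
      then have "\<not> g y > 0" "\<not> g y < 0"
        using out[of y] N(5) yS S by auto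
      then show ?thesis by simp
    qed
    define w where "w = adjoint (blinfun_apply (D y)) 1"
    have w: "w \<bullet> h = D y h" for h
      using adjoint_works[OF bounded_linear.linear[OF blinfun.bounded_linear_right[of "D y"]], of h 1] by (simp add: w_def inner_commute)
    have nw: "norm w \<ge> c"
    proof -
      have "norm (D y) \<le> norm w"
        by (rule norm_blinfun_bound) (use w Cauchy_Schwarz_ineq2[of w] in \<open>auto simp flip: w\<close>)
      then show ?thesis using Dlow[OF yS] by linarith
    qed
    show ?thesis
    proof (rule pinched_normalize[OF nw c])
      fix h :: 'a assume h: "norm h < \<rho>"
      have "dist x (y + h) \<le> dist y x + norm h"
        using norm_triangle_ineq[of "y - x" h] by (simp add: dist_norm norm_minus_commute algebra_simps)
      then have yhS: "y + h \<in> S"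
        using y h by (simp add: S_def)
      have "norm (g (y + h) - g y - D y h) \<le> M * (norm h)\<^sup>2"
        unfolding D_def
        by (rule taylor_quadratic_bound[where S=S]) (use S yS yhS M d1 d2 bd in \<open>auto simp: D_def\<close>)
      then have t: "\<bar>g (y + h) - w \<bullet> h\<bar> \<le> M * (norm h)\<^sup>2"
        by (simp add: gy w)
      show "y + h \<in> E" if "w \<bullet> h < - M * (norm h)\<^sup>2"
      proof -
        have "g (y + h) < 0" using t that by (simp add: abs_le_iff)
        then have "y + h \<in> U" using N(5) yhS S by blast
        then show ?thesis using U(2) closure_subset by blast
      qed
      show "y + h \<notin> E" if "w \<bullet> h > M * (norm h)\<^sup>2"
      proof -
        have "g (y + h) > 0" using t that by (simp add: abs_le_iff)
        then show ?thesis using out[of "y + h"] yhS S U(2) by blast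
      qed
    qed (use M in auto)
  qed
  then show ?thesis using \<rho> M c by (intro exI[of _ "M / c"] conjI exI[of _ \<rho>]) auto
qed

lemma continuous_compact_support_bounded:
  fixes f :: "'a::euclidean_space \<Rightarrow> 'b::real_normed_vector"
  assumes "continuous_on UNIV f" and "\<And>y. norm (y - x) > 1 \<Longrightarrow> f y = 0"
  shows "(SUP y. ennreal (norm (f y))) < \<infinity>"
proof -
  have "compact (f ` cball x 1)"
    using assms(1) by (intro compact_continuous_image) (auto intro: continuous_on_subset)
  then obtain B where B: "\<And>y. y \<in> cball x 1 \<Longrightarrow> norm (f y) \<le> B"
    using compact_imp_bounded[OF \<open>compact (f ` cball x 1)\<close>] unfolding bounded_iff by blast
  have "norm (f y) \<le> max B 0" for y
    using B[of y] assms(2)[of y] by (cases "y \<in> cball x 1") (auto simp: dist_norm norm_minus_commute)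
  then have "(SUP y. ennreal (norm (f y))) \<le> ennreal (max B 0)"
    by (intro SUP_least ennreal_leI)
  then show ?thesis by (simp add: le_less_trans)
qed

lemma deriv_blinfun_eq_0_on_open:
  assumes "open S" "x \<in> S" "\<And>y. y \<in> S \<Longrightarrow> f y = 0"
  shows "deriv_blinfun f x = 0"
proof (rule deriv_blinfun_eqI)
  have "((\<lambda>_. 0) has_derivative (\<lambda>_. 0)) (at x)" by simp
  then show "(f has_derivative blinfun_apply 0) (at x)"
    by (rule has_derivative_transform_within_open[OF _ assms(1,2), THEN has_derivative_eq_rhs])
      (use assms(3) in \<open>auto simp: fun_eq_iff\<close>)
qed

text \<open>
  Finiteness is needed because \<open>enn2real\<close> maps \<open>\<infinity>\<close> to 0.
\<close>
lemma C2_norm_finite: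
  fixes \<Phi> :: "'a::euclidean_space \<Rightarrow> 'a"
  assumes \<Phi>: "C2_on \<Phi> UNIV" and supp: "\<And>y. norm (y - x) \<ge> 1 \<Longrightarrow> \<Phi> y = y"
  shows "C2_norm (\<lambda>y. \<Phi> y - y) < \<infinity>"
proof -
  define u where "u = (\<lambda>y. \<Phi> y - y)"
  let ?D = "deriv_blinfun u"
  have C2: "C2_on u UNIV"
    using C2_on_minus_id[OF \<Phi>] by (simp add: u_def)
  let ?S = "{y. norm (y - x) > 1}"
  have S: "open ?S"
    by (intro open_Collect_less continuous_intros)
  have 0: "u y = 0" if "norm (y - x) > 1" for y
    using supp[of y] that by (simp add: u_def)
  have 1: "?D y = 0" if "norm (y - x) > 1" for y
    by (rule deriv_blinfun_eq_0_on_open[OF S]) (use that 0 in auto)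
  have 2: "deriv_blinfun ?D y = 0" if "norm (y - x) > 1" for y
    by (rule deriv_blinfun_eq_0_on_open[OF S]) (use that 1 in auto)
  have c: "continuous_on UNIV u" "continuous_on UNIV ?D" "continuous_on UNIV (deriv_blinfun ?D)"
    using C2 unfolding C2_on_def
    by (auto intro!: continuous_at_imp_continuous_on differentiable_imp_continuous_within)
  show ?thesis
    using continuous_compact_support_bounded[OF c(1) 0] continuous_compact_support_bounded[OF c(2) 1]
      continuous_compact_support_bounded[OF c(3) 2]
    unfolding C2_norm_def u_def by (simp add: ennreal_add_less_top)
qed

lemma C2_diffeo_continuous:
  assumes "C2_diffeo \<Phi>"
  shows "bij \<Phi>" "continuous_on UNIV (inv \<Phi>)"
  using assms unfolding C2_diffeo_def C2_on_def
  by (auto intro!: continuous_at_imp_continuous_on differentiable_imp_continuous_within)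

lemma frontier_homeomorphic_image:
  assumes bij: "bij \<Phi>" and cont: "continuous_on UNIV (inv \<Phi>)" and E: "closed E"
    and p: "p \<in> frontier (\<Phi> ` E)"
  shows "inv \<Phi> p \<in> frontier E"
proof -
  have vi: "\<Phi> ` S = inv \<Phi> -` S" for S
    using bij bij_vimage_eq_inv_image[OF bij_imp_bij_inv[OF bij], of S] by (simp add: inv_inv_eq)
  have "closed (inv \<Phi> -` E)"
    using cont E by (intro closed_vimage)
  then have "closed (\<Phi> ` E)"
    by (simp only: vi)
  then have 1: "inv \<Phi> p \<in> E"
    using p frontier_subset_closed[of "\<Phi> ` E"] unfolding vi[of E] by blast
  have "open (inv \<Phi> -` interior E)"
    using cont by (intro open_vimage) auto
  then have "open (\<Phi> ` interior E)"
    by (simp only: vi)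
  moreover have "\<Phi> ` interior E \<subseteq> \<Phi> ` E"
    using interior_subset by blast
  ultimately have "\<Phi> ` interior E \<subseteq> interior (\<Phi> ` E)"
    by (simp add: interior_maximal)
  then have "inv \<Phi> p \<notin> interior E"
    using p unfolding frontier_def vi[of "interior E"] by blast
  then show ?thesis using 1 E by (simp add: frontier_def)
qed


section \<open>Properties of the nonlocal curvature\<close>

context curvature_kernel
begin

text \<open>
  Both forms of continuity follow from this estimate. The points \<open>x\<close> and \<open>y\<close> at which \<open>E\<close> is
  pinched may differ: uniform continuity takes \<open>y = x\<close>, whereas sequential continuity needs the case where \<open>y\<close>
  is the preimage of a boundary point of the nearby set.
\<close>
lemma nonlocal_curvature_stable:
  assumes K: "K > 0" and \<rho>: "\<rho> > 0" and \<eta>: "\<eta> > 0"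
  shows "\<exists>\<epsilon>>0. \<forall>E x y \<Phi>. closed E \<and> pinched E x K \<rho> \<and> pinched E y K \<rho> \<and> C2_diffeo \<Phi> \<and>
    C2_norm (\<lambda>z. \<Phi> z - z) \<le> ennreal \<epsilon> \<and> dist (\<Phi> y) x \<le> \<epsilon> \<longrightarrow>
    \<bar>nonlocal_curvature \<phi> x E - nonlocal_curvature \<phi> (\<Phi> y) (\<Phi> ` E)\<bar> \<le> \<eta>"
proof -
  \<comment> \<open>Only \<open>c \<ge> 0\<close> matters, so that the value of \<open>kappa\<close> need not be known.\<close>
  define c where "c = 1 / kappa TYPE('a)"
  have c: "c \<ge> 0" by (simp add: c_def kappa_def)
  define \<eta>' where "\<eta>' = \<eta> / (c + 1)"
  have \<eta>': "\<eta>' > 0" "c * \<eta>' \<le> \<eta>"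
    using c \<eta> by (auto simp: \<eta>'_def divide_simps add_nonneg_pos algebra_simps)
  define K' where "K' = 6 * K + 6"
  have K': "K' > 0" "K \<le> K'" using K by (simp_all add: K'_def)
  have \<rho>': "\<rho> / 2 > 0" using \<rho> by simp
  obtain \<epsilon> where \<epsilon>: "\<epsilon> > 0" and stab: "\<And>E x \<Phi> p. E \<in> sets borel \<Longrightarrow> near_isometry \<epsilon> \<Phi> \<Longrightarrow> dist p x \<le> \<epsilon> \<Longrightarrow>
    pinched E x K' (\<rho> / 2) \<Longrightarrow> pinched (\<Phi> ` E) p K' (\<rho> / 2) \<Longrightarrow>
    \<bar>curvature_integral x E - curvature_integral p (\<Phi> ` E)\<bar> \<le> \<eta>'"
    using curvature_integral_stable[OF K'(1) \<rho>' \<eta>'(1)] by blast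
  define e where "e = min (1 / 2) (\<epsilon> / 2)"
  have e: "0 < e" "e \<le> 1 / 2" "2 * e \<le> \<epsilon>" "e \<le> \<epsilon>"
    using \<epsilon> by (simp_all add: e_def min_le_iff_disj)
  show ?thesis
  proof (intro exI[of _ e] conjI allI impI, goal_cases)
    case (2 E x y \<Phi>)
    then have E: "closed E" and pin: "pinched E x K \<rho>" "pinched E y K \<rho>" and \<Phi>: "C2_diffeo \<Phi>"
      and n: "C2_norm (\<lambda>z. \<Phi> z - z) \<le> ennreal e" and d: "dist (\<Phi> y) x \<le> e"
      by auto
    have n2: "C2_norm (\<lambda>z. \<Phi> z - z) \<le> ennreal (1 / 2)"
      using order_trans[OF n ennreal_leI[OF e(2)]] .
    have ni: "near_isometry \<epsilon> \<Phi>"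
      using near_isometry_mono[OF C2_near_identity[OF \<Phi> less_imp_le[OF e(1)] e(2) n] e(3)] .
    have bE: "E \<in> sets borel" using E by simp
    have bF: "\<Phi> ` E \<in> sets borel" by (rule near_isometry_borel_image[OF ni bE])
    have p1: "pinched E x K' (\<rho> / 2)"
      by (rule pinched_mono[OF pin(1) K'(2)]) (use \<rho> in simp)
    have p2: "pinched (\<Phi> ` E) (\<Phi> y) K' (\<rho> / 2)"
      unfolding K'_def by (rule pinched_C2_image[OF \<Phi> n2 less_imp_le[OF K] pin(2)])
    have "\<bar>curvature_integral x E - curvature_integral (\<Phi> y) (\<Phi> ` E)\<bar> \<le> \<eta>'"
      by (rule stab[OF bE ni _ p1 p2]) (use d e in simp)
    then have "c * \<bar>curvature_integral x E - curvature_integral (\<Phi> y) (\<Phi> ` E)\<bar> \<le> c * \<eta>'"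
      using c by (rule mult_left_mono)
    also have "\<dots> \<le> \<eta>" by fact
    finally show ?case
      unfolding nonlocal_curvature_eq(2)[OF bE K'(1) p1 \<rho>'] nonlocal_curvature_eq(2)[OF bF K'(1) p2 \<rho>'] c_def[symmetric]
      using c by (simp add: right_diff_distrib[symmetric] abs_mult)
  qed (use e in auto)
qed

lemma nonlocal_curvature_exists_C2:
  assumes "E \<in> C2_sets" "x \<in> frontier E"
  shows "nonlocal_curvature_exists \<phi> x E"
proof -
  obtain K \<rho> where "K > 0" "\<rho> > 0" "pinched E x K \<rho>"
    using C2_sets_pinched[OF assms] assms(2) by force
  then show ?thesis
    using nonlocal_curvature_eq(1) C2_sets_closed[OF assms(1)] by (metis borel_closed)
qed

lemma nonlocal_curvature_antimono:
  assumes E: "E \<in> sets borel" and F: "F \<in> sets borel" and sub: "E \<subseteq> F"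
    and ex: "nonlocal_curvature_exists \<phi> x E" "nonlocal_curvature_exists \<phi> x F"
  shows "nonlocal_curvature \<phi> x F \<le> nonlocal_curvature \<phi> x E"
proof -
  obtain l m where l: "(truncated_curvature \<phi> x E \<longlongrightarrow> l) (at_right 0)"
    and m: "(truncated_curvature \<phi> x F \<longlongrightarrow> m) (at_right 0)"
    using ex unfolding nonlocal_curvature_exists_def by blast
  have "truncated_curvature \<phi> x F r \<le> truncated_curvature \<phi> x E r" if r: "r > 0" for r
    unfolding truncated_curvature_eq(2)[OF E r] truncated_curvature_eq(2)[OF F r]
    by (intro integral_mono far_chi_integrable r E F mult_left_mono far_nonneg)
      (use sub in \<open>auto simp: chi_tilde_eq indicator_def\<close>)
  then have "\<forall>\<^sub>F r in at_right 0. truncated_curvature \<phi> x F r \<le> truncated_curvature \<phi> x E r"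
    using eventually_at_right_less by (rule eventually_mono[rotated])
  then have "m \<le> l"
    by (rule tendsto_le[OF trivial_limit_at_right_real l m])
  then show ?thesis
    unfolding nonlocal_curvature_def tendsto_Lim[OF trivial_limit_at_right_real l]
      tendsto_Lim[OF trivial_limit_at_right_real m]
    by (intro mult_left_mono) (simp_all add: kappa_def)
qed

lemma nonlocal_curvature_translate:
  assumes E: "closed E"
  shows "nonlocal_curvature \<phi> (x + z) ((\<lambda>y. y + z) ` E) = nonlocal_curvature \<phi> x E"
proof -
  define F where "F = (\<lambda>y. y + z) ` E"
  have "closed F"
    using closed_translation[OF E, of z] by (simp add: F_def add.commute[of _ z])
  then have [measurable]: "F \<in> sets borel" by simp
  have mem: "h + z \<in> F \<longleftrightarrow> h \<in> E" for h
    by (auto simp: F_def)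
  have "truncated_curvature \<phi> (x + z) F r = truncated_curvature \<phi> x E r" for r
  proof -
    have [measurable]: "ball (x + z) r \<in> sets borel" by simp
    have "truncated_curvature \<phi> (x + z) F r =
      (LINT h|lborel. indicator (- ball (x + z) r) (z + h) *\<^sub>R (chi_tilde F (z + h) * \<phi> (x + z - (z + h))))"
      unfolding truncated_curvature_def set_lebesgue_integral_def
      by (rule lborel_integral_translate(1)) measurable
    also have "\<dots> = truncated_curvature \<phi> x E r"
      unfolding truncated_curvature_def set_lebesgue_integral_def
      by (intro Bochner_Integration.integral_cong)
        (auto simp: chi_tilde_eq indicator_def mem dist_norm algebra_simps)
    finally show ?thesis .
  qed
  then have "truncated_curvature \<phi> (x + z) F = truncated_curvature \<phi> x E"
    by (rule ext)
  then show ?thesis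
    by (simp add: nonlocal_curvature_def F_def)
qed

lemma nonlocal_curvature_uniform_continuity:
  assumes R: "R > 0"
  shows "\<exists>\<omega>. modulus_of_continuity \<omega> \<and>
    (\<forall>E x \<Phi>. E \<in> C2_sets \<and> x \<in> frontier E \<and>
       interior_ball_condition R E x \<and> exterior_ball_condition R E x \<and>
       C2_diffeo \<Phi> \<and> (\<forall>y. norm (y - x) \<ge> 1 \<longrightarrow> \<Phi> y = y) \<longrightarrow>
       ennreal \<bar>nonlocal_curvature \<phi> x E - nonlocal_curvature \<phi> (\<Phi> x) (\<Phi> ` E)\<bar>
         \<le> \<omega> (enn2real (C2_norm (\<lambda>y. \<Phi> y - y))))"
proof -
  \<comment> \<open>The smallest possible modulus: the supremum of the differences over all admissible data.\<close>
  define T where "T = (\<lambda>s::real. {(E :: 'a set, x, \<Phi>). E \<in> C2_sets \<and> x \<in> frontier E \<and>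
       interior_ball_condition R E x \<and> exterior_ball_condition R E x \<and>
       C2_diffeo \<Phi> \<and> (\<forall>y. norm (y - x) \<ge> 1 \<longrightarrow> \<Phi> y = y) \<and> C2_norm (\<lambda>y. \<Phi> y - y) \<le> ennreal s})"
  define D where "D = (\<lambda>(E, x, \<Phi>). ennreal \<bar>nonlocal_curvature \<phi> x E - nonlocal_curvature \<phi> (\<Phi> x) (\<Phi> ` E)\<bar>)"
  define \<omega> where "\<omega> = (\<lambda>s. SUP t\<in>T s. D t)"
  have "mono_on {0..} \<omega>"
  proof (rule mono_onI)
    fix r s :: real assume "r \<le> s"
    then have "ennreal r \<le> ennreal s" by (rule ennreal_leI)
    then have "T r \<subseteq> T s"
      unfolding T_def using order_trans by blast
    then show "\<omega> r \<le> \<omega> s"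
      unfolding \<omega>_def by (intro SUP_subset_mono) auto
  qed
  moreover have "\<omega> 0 = 0"
  proof -
    have "D t \<le> 0" if t: "t \<in> T 0" for t
    proof -
      obtain E x \<Phi> where t': "t = (E, x, \<Phi>)" by (cases t)
      have "C2_norm (\<lambda>y. \<Phi> y - y) \<le> ennreal 0"
        using t by (simp add: T_def t')
      then have "\<Phi> y = y" for y
        using C2_normD(1)[of "\<lambda>y. \<Phi> y - y" 0 y] by simp
      then show ?thesis by (simp add: D_def t')
    qed
    then have "\<omega> 0 \<le> 0" unfolding \<omega>_def by (rule SUP_least)
    then show ?thesis by simp
  qed
  moreover have "(\<omega> \<longlongrightarrow> 0) (at_right 0)"
  proof (rule order_tendstoI)
    fix a :: ennreal assume "0 < a"
    then obtain b where b: "0 < b" "b < a" using dense by blast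
    then have "b \<noteq> top" using top_greatest[of a] leD by blast
    then obtain \<eta> where b\<eta>: "b = ennreal \<eta>" by (cases b) auto
    have \<eta>: "\<eta> > 0" using b(1) by (simp add: b\<eta>)
    have K: "1 / (2 * R) > 0" using R by simp
    obtain \<epsilon> where \<epsilon>: "\<epsilon> > 0" and st: "\<And>E x y \<Phi>. closed E \<Longrightarrow> pinched E x (1 / (2 * R)) 1 \<Longrightarrow>
        pinched E y (1 / (2 * R)) 1 \<Longrightarrow> C2_diffeo \<Phi> \<Longrightarrow>
        C2_norm (\<lambda>z. \<Phi> z - z) \<le> ennreal \<epsilon> \<Longrightarrow> dist (\<Phi> y) x \<le> \<epsilon> \<Longrightarrow>
        \<bar>nonlocal_curvature \<phi> x E - nonlocal_curvature \<phi> (\<Phi> y) (\<Phi> ` E)\<bar> \<le> \<eta>"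
      using nonlocal_curvature_stable[OF K zero_less_one \<eta>] by blast
    have "\<omega> s \<le> b" if s: "s < \<epsilon>" for s
      unfolding \<omega>_def
    proof (rule SUP_least)
      fix t assume t: "t \<in> T s"
      obtain E x \<Phi> where t': "t = (E, x, \<Phi>)" by (cases t)
      have *: "E \<in> C2_sets" "interior_ball_condition R E x" "exterior_ball_condition R E x" "C2_diffeo \<Phi>"
        "C2_norm (\<lambda>y. \<Phi> y - y) \<le> ennreal s"
        using t by (auto simp: T_def t')
      have n: "C2_norm (\<lambda>y. \<Phi> y - y) \<le> ennreal \<epsilon>"
        using order_trans[OF *(5) ennreal_leI[OF less_imp_le[OF s]]] .
      note pin = ball_conditions_imp_pinched[OF R *(2,3), of 1]
      have "dist (\<Phi> x) x \<le> \<epsilon>"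
        using C2_normD(1)[OF n less_imp_le[OF \<epsilon>], of x] by (simp add: dist_norm)
      from st[OF C2_sets_closed[OF *(1)] pin pin *(4) n this]
      show "D t \<le> b" unfolding b\<eta> by (simp add: D_def t' ennreal_leI)
    qed
    moreover have "\<forall>\<^sub>F s in at_right 0. s < \<epsilon>"
      by (rule order_tendstoD(2)[OF tendsto_ident_at]) (use \<epsilon> in simp)
    ultimately show "\<forall>\<^sub>F s in at_right 0. \<omega> s < a"
      by (auto elim!: eventually_mono intro: le_less_trans[OF _ b(2)])
  qed simp
  ultimately have "modulus_of_continuity \<omega>"
    by (simp add: modulus_of_continuity_def)
  moreover have "ennreal \<bar>nonlocal_curvature \<phi> x E - nonlocal_curvature \<phi> (\<Phi> x) (\<Phi> ` E)\<bar>
         \<le> \<omega> (enn2real (C2_norm (\<lambda>y. \<Phi> y - y)))"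
    if "E \<in> C2_sets \<and> x \<in> frontier E \<and>
       interior_ball_condition R E x \<and> exterior_ball_condition R E x \<and>
       C2_diffeo \<Phi> \<and> (\<forall>y. norm (y - x) \<ge> 1 \<longrightarrow> \<Phi> y = y)" for E x \<Phi>
  proof -
    have "C2_norm (\<lambda>y. \<Phi> y - y) < \<infinity>"
      using that by (intro C2_norm_finite[of \<Phi> x]) (auto simp: C2_diffeo_def)
    then have "(E, x, \<Phi>) \<in> T (enn2real (C2_norm (\<lambda>y. \<Phi> y - y)))"
      using that by (simp add: T_def)
    then have "D (E, x, \<Phi>) \<le> \<omega> (enn2real (C2_norm (\<lambda>y. \<Phi> y - y)))"
      unfolding \<omega>_def by (rule SUP_upper)
    then show ?thesis by (simp add: D_def)
  qed
  ultimately show ?thesis by blast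
qed

lemma nonlocal_curvature_continuous:
  assumes conv: "C2_sets_converge En E" and xn: "\<And>n. xn n \<in> frontier (En n)"
    and lim: "xn \<longlonglongrightarrow> x" and x: "x \<in> frontier E"
  shows "(\<lambda>n. nonlocal_curvature \<phi> (xn n) (En n)) \<longlonglongrightarrow> nonlocal_curvature \<phi> x E"
proof (rule tendstoI)
  fix \<eta> :: real assume \<eta>: "\<eta> > 0"
  then have \<eta>2: "\<eta> / 2 > 0" by simp
  obtain \<Phi> where E: "E \<in> C2_sets" and \<Phi>: "\<And>n. C2_diffeo (\<Phi> n)" "\<And>n. En n = \<Phi> n ` E"
    and n: "(\<lambda>n. C2_norm (\<lambda>y. \<Phi> n y - y)) \<longlonglongrightarrow> 0"
    using conv unfolding C2_sets_converge_def by blast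
  obtain K \<rho> where K: "K > 0" and \<rho>: "\<rho> > 0"
    and pin: "\<And>y. y \<in> frontier E \<Longrightarrow> dist y x < \<rho> \<Longrightarrow> pinched E y K \<rho>"
    using C2_sets_pinched[OF E x] by blast
  obtain \<epsilon> where \<epsilon>: "\<epsilon> > 0" and st: "\<And>E x y \<Phi>. closed E \<Longrightarrow> pinched E x K \<rho> \<Longrightarrow>
      pinched E y K \<rho> \<Longrightarrow> C2_diffeo \<Phi> \<Longrightarrow>
      C2_norm (\<lambda>z. \<Phi> z - z) \<le> ennreal \<epsilon> \<Longrightarrow> dist (\<Phi> y) x \<le> \<epsilon> \<Longrightarrow>
      \<bar>nonlocal_curvature \<phi> x E - nonlocal_curvature \<phi> (\<Phi> y) (\<Phi> ` E)\<bar> \<le> \<eta> / 2"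
    using nonlocal_curvature_stable[OF K \<rho> \<eta>2] by blast
  define e where "e = min \<epsilon> (\<rho> / 2)"
  have e: "e > 0" "e \<le> \<epsilon>" "2 * e \<le> \<rho>"
    using \<epsilon> \<rho> by (simp_all add: e_def min_le_iff_disj)
  have "\<forall>\<^sub>F n in sequentially. C2_norm (\<lambda>y. \<Phi> n y - y) < ennreal e"
    using n e by (intro order_tendstoD(2)) auto
  moreover have "\<forall>\<^sub>F n in sequentially. dist (xn n) x < e"
    using lim e by (intro tendstoD)
  ultimately show "\<forall>\<^sub>F n in sequentially.
    dist (nonlocal_curvature \<phi> (xn n) (En n)) (nonlocal_curvature \<phi> x E) < \<eta>"
  proof eventually_elim
    case (elim n)
    define y where "y = inv (\<Phi> n) (xn n)"
    note cont = C2_diffeo_continuous[OF \<Phi>(1)[of n]]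
    have xy: "xn n = \<Phi> n y"
      using cont(1) by (simp add: y_def bij_is_surj surj_f_inv_f)
    have yE: "y \<in> frontier E"
      unfolding y_def
      by (rule frontier_homeomorphic_image[OF cont(1,2) C2_sets_closed[OF E]]) (use xn[of n] \<Phi>(2) in simp)
    have "norm (\<Phi> n y - y) \<le> e"
      by (rule C2_normD(1)[of "\<lambda>y. \<Phi> n y - y"]) (use elim e in auto)
    then have "dist y x < \<rho>"
      using elim(2) e(3) dist_triangle[of y x "xn n"] unfolding xy by (simp add: dist_norm norm_minus_commute)
    then have "\<bar>nonlocal_curvature \<phi> x E - nonlocal_curvature \<phi> (\<Phi> n y) (\<Phi> n ` E)\<bar> \<le> \<eta> / 2"
      using elim e xy x yE \<rho> order_trans[OF less_imp_le[OF elim(1)] ennreal_leI[OF e(2)]]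
      by (intro st C2_sets_closed[OF E] pin \<Phi>(1)) auto
    then show ?case
      using \<eta> unfolding \<Phi>(2) xy[symmetric] by (simp add: dist_real_def abs_minus_commute)
  qed
qed

end

theorem proposition3p1:
  fixes \<phi> j :: "'a::euclidean_space \<Rightarrow> real"
  assumes dim: "DIM('a) \<ge> 2"
    and phi_measurable: "\<phi> \<in> borel_measurable borel"
    and phi_nonneg: "\<And>x. \<phi> x \<ge> 0"
    and phi_even: "\<And>x. \<phi> x = \<phi> (- x)"
    and phi_le: "\<And>x. \<phi> x \<le> j x"
    and j_measurable: "j \<in> borel_measurable borel"
    and j_nonneg: "\<And>x. j x \<ge> 0"
    and j_radial: "radial j"
    and j_mono: "radially_nonincreasing j"
    and j_integrable: "integrable lborel (\<lambda>x. min 1 (norm x) * j x)"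
  shows
    "(\<forall>E x. E \<in> C2_sets \<and> x \<in> frontier E \<longrightarrow> nonlocal_curvature_exists \<phi> x E) \<and>
     \<comment> \<open>(M)\<close>
     (\<forall>E F x. E \<in> C2_sets \<and> F \<in> C2_sets \<and> E \<subseteq> F \<and> x \<in> frontier E \<inter> frontier F \<longrightarrow>
        nonlocal_curvature \<phi> x F \<le> nonlocal_curvature \<phi> x E) \<and>
     \<comment> \<open>(T)\<close>
     (\<forall>E x z. E \<in> C2_sets \<and> x \<in> frontier E \<longrightarrow>
        nonlocal_curvature \<phi> x E = nonlocal_curvature \<phi> (x + z) ((\<lambda>y. y + z) ` E)) \<and>
     \<comment> \<open>(C')\<close>
     (\<forall>R>0. \<exists>\<omega>. modulus_of_continuity \<omega> \<and>
        (\<forall>E x \<Phi>. E \<in> C2_sets \<and> x \<in> frontier E \<and>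
           interior_ball_condition R E x \<and> exterior_ball_condition R E x \<and>
           C2_diffeo \<Phi> \<and> (\<forall>y. norm (y - x) \<ge> 1 \<longrightarrow> \<Phi> y = y) \<longrightarrow>
           ennreal \<bar>nonlocal_curvature \<phi> x E - nonlocal_curvature \<phi> (\<Phi> x) (\<Phi> ` E)\<bar>
             \<le> \<omega> (enn2real (C2_norm (\<lambda>y. \<Phi> y - y))))) \<and>
     \<comment> \<open>(C)\<close>
     (\<forall>En E xn x. C2_sets_converge En E \<and> (\<forall>n. xn n \<in> frontier (En n)) \<and>
        xn \<longlonglongrightarrow> x \<and> x \<in> frontier E \<longrightarrow>
        (\<lambda>n. nonlocal_curvature \<phi> (xn n) (En n)) \<longlonglongrightarrow> nonlocal_curvature \<phi> x E)"
proof -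
  interpret curvature_kernel \<phi> j
    by unfold_locales fact+
  show ?thesis
  proof (intro conjI allI impI; (elim conjE)?)
    show "nonlocal_curvature_exists \<phi> x E" if "E \<in> C2_sets" "x \<in> frontier E" for E x
      using that by (rule nonlocal_curvature_exists_C2)
    show "nonlocal_curvature \<phi> x F \<le> nonlocal_curvature \<phi> x E"
      if "E \<in> C2_sets" "F \<in> C2_sets" "E \<subseteq> F" "x \<in> frontier E \<inter> frontier F" for E F x
      using that by (intro nonlocal_curvature_antimono nonlocal_curvature_exists_C2)
        (auto intro: borel_closed C2_sets_closed)
    show "nonlocal_curvature \<phi> x E = nonlocal_curvature \<phi> (x + z) ((\<lambda>y. y + z) ` E)"
      if "E \<in> C2_sets" "x \<in> frontier E" for E x z
      using nonlocal_curvature_translate[OF C2_sets_closed[OF that(1)]] by simp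
  qed (use nonlocal_curvature_uniform_continuity nonlocal_curvature_continuous in blast)+
qed

end
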